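(* Let $d>2$, let $\Omega\subseteq\mathbb{R}^d$ be open, and let $2\le k\le d-1$ and $p\ge 1$ be integers/reals. Let $f\in W^{1,p}(\Omega,\mathbb{R}^d)$ and suppose that either $\det df>0$ a.e. in $\Omega$ or $\det df<0$ a.e. in $\Omega$. Suppose further that the a.e.-defined map $x\mapsto \bigwedge^k df_x$ has a smooth representative $\Omega\to\operatorname{End}(\bigwedge^k\mathbb{R}^d)$ which takes values in $\operatorname{GL}(\bigwedge^k\mathbb{R}^d)$ at every point. If $k$ and $d$ are not both even, then $f$ is smooth (i.e. $f$ has a $C^\infty$ representative). Moreover, if $k$ is odd, the assumption on the sign of $\det df$ can be omitted. *)

theory Defs
  imports "HOL-Analysis.Analysis"
begin

fun Ck_on :: "nat \<Rightarrow> 'a::euclidean_space set \<Rightarrow> ('a \<Rightarrow> 'b::euclidean_space) \<Rightarrow> bool" where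
  "Ck_on 0 U g = continuous_on U g"
| "Ck_on (Suc n) U g =
     (g differentiable_on U \<and> (\<forall>v. Ck_on n U (\<lambda>x. frechet_derivative g (at x) v)))"

definition smooth_on :: "'a::euclidean_space set \<Rightarrow> ('a \<Rightarrow> 'b::euclidean_space) \<Rightarrow> bool" where
  "smooth_on U g \<longleftrightarrow> (\<forall>n. Ck_on n U g)"

definition test_fun :: "(real^'n) set \<Rightarrow> (real^'n \<Rightarrow> real) \<Rightarrow> bool" where
  "test_fun \<Omega> \<phi> \<longleftrightarrow> smooth_on UNIV \<phi> \<and> compact (closure {x. \<phi> x \<noteq> 0})
      \<and> closure {x. \<phi> x \<noteq> 0} \<subseteq> \<Omega>"

definition partial_deriv :: "'n \<Rightarrow> (real^'n \<Rightarrow> real) \<Rightarrow> real^'n \<Rightarrow> real" where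
  "partial_deriv j \<phi> x = frechet_derivative \<phi> (at x) (axis j 1)"

definition weak_partial :: "(real^'n) set \<Rightarrow> (real^'n \<Rightarrow> real) \<Rightarrow> 'n \<Rightarrow> (real^'n \<Rightarrow> real) \<Rightarrow> bool" where
  "weak_partial \<Omega> u j g \<longleftrightarrow> (\<forall>\<phi>. test_fun \<Omega> \<phi> \<longrightarrow>
      (LINT x:\<Omega>|lebesgue. u x * partial_deriv j \<phi> x) = - (LINT x:\<Omega>|lebesgue. g x * \<phi> x))"

definition Lp_on :: "(real^'n) set \<Rightarrow> real \<Rightarrow> (real^'n \<Rightarrow> real) \<Rightarrow> bool" where
  "Lp_on \<Omega> p u \<longleftrightarrow> u \<in> borel_measurable (lebesgue_on \<Omega>)
      \<and> integrable (lebesgue_on \<Omega>) (\<lambda>x. \<bar>u x\<bar> powr p)"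

definition sobolev_W1p_with_deriv ::
    "(real^'n) set \<Rightarrow> real \<Rightarrow> (real^'n \<Rightarrow> real^'n) \<Rightarrow> (real^'n \<Rightarrow> real^'n^'n) \<Rightarrow> bool" where
  "sobolev_W1p_with_deriv \<Omega> p f Df \<longleftrightarrow>
     (\<forall>i. Lp_on \<Omega> p (\<lambda>x. f x $ i)) \<and>
     (\<forall>i j. Lp_on \<Omega> p (\<lambda>x. Df x $ i $ j) \<and> weak_partial \<Omega> (\<lambda>x. f x $ i) j (\<lambda>x. Df x $ i $ j))"

definition ksets :: "nat \<Rightarrow> 'n set set" where
  "ksets k = {I. card I = k}"

text \<open>A fixed enumeration of each k-subset; basis vector e_I = e_{enum 0} \<and> ... \<and> e_{enum (k-1)}.\<close>
definition kenum :: "nat \<Rightarrow> 'n set \<Rightarrow> nat \<Rightarrow> 'n" where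
  "kenum k I = (SOME e. bij_betw e {..<k} I)"

definition det_nat :: "nat \<Rightarrow> (nat \<Rightarrow> nat \<Rightarrow> real) \<Rightarrow> real" where
  "det_nat k M = (\<Sum>\<sigma> | \<sigma> permutes {..<k}. of_int (sign \<sigma>) * (\<Prod>i<k. M i (\<sigma> i)))"

text \<open>Matrix of \<Lambda>^k A in the basis (e_I)_{I \<in> ksets k}: entry (I,J) is the minor det A[I,J].\<close>
definition ext_power :: "nat \<Rightarrow> real^'n^'n \<Rightarrow> 'n set \<Rightarrow> 'n set \<Rightarrow> real" where
  "ext_power k A I J = det_nat k (\<lambda>a b. A $ kenum k I a $ kenum k J b)"

definition invertible_on :: "'i set \<Rightarrow> ('i \<Rightarrow> 'i \<Rightarrow> real) \<Rightarrow> bool" where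
  "invertible_on S M \<longleftrightarrow> (\<exists>N. \<forall>I\<in>S. \<forall>J\<in>S.
      (\<Sum>K\<in>S. M I K * N K J) = (if I = J then 1 else 0) \<and>
      (\<Sum>K\<in>S. N I K * M K J) = (if I = J then 1 else 0))"

end

theory Submission
  imports Defs "Jordan_Normal_Form.Determinant"
begin

text \<open>Near the identity, \<open>B\<close> is an explicit smooth function of \<open>\<Lambda>\<^sup>k B\<close> up to sign: for an index set
  \<open>I\<close> with \<open>k + 1\<close> elements the entries of \<open>\<Lambda>\<^sup>k B\<close> contain the adjugate of the submatrix \<open>B[I,I]\<close>, and a
  \<open>(k+1) \<times> (k+1)\<close> matrix \<open>X\<close> satisfies \<open>X = det X \<cdot> (adj X)\<^sup>-\<^sup>1\<close> with \<open>(det X)\<^sup>k = det (adj X)\<close>. For odd \<open>k\<close> there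
  is no sign ambiguity; for even \<open>k\<close> the sign is the same for all \<open>I\<close>, and in odd dimension it is the
  sign of \<open>det B\<close>. Multiplying \<open>df\<close> by the inverse of its value at a nearby point reduces to this
  situation, so the weak derivative of \<open>f\<close> has a smooth representative. A function whose weak gradient
  is smooth is smooth: the gradient is curl-free, hence has locally a classical primitive, and a
  function with vanishing weak gradient is constant. Only tensor products of one-dimensional bump
  functions are needed as test functions.\<close>

subsection \<open>Determinants and adjugates of matrices indexed by numbers\<close>

hide_const (open) Determinant.det Matrix.mat Matrix.vec Matrix.row Matrix.col

hide_fact (open) Matrix.mat_def Matrix.vec_eq_iff Determinant.det_def
no_notation Matrix.vec_index (infixl "$" 100)

text \<open>Two obstacles shape the argument. First, \<open>Df\<close> is controlled only almost
  everywhere, so the given point itself may be useless for the normalisation. A neighbourhood is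
  therefore fixed in advance on which every quotient of two values of the smooth exterior power is
  near the identity, and only then is a point picked in it where the a.e. identities hold. Second, a
  \<open>k\<close>-th root of det (adj X) gives det X only up to sign when \<open>k\<close> is even.
  The signs belonging to different index sets agree because each is the sign of diagonal entries of
  \<open>B\<close>, and any two indices lie in a common set of size \<open>k + 1\<close>. What
  remains is the choice between \<open>B\<close> and \<open>-B\<close>, which have the same exterior
  power for even \<open>k\<close>; the determinant separates them exactly in odd dimension. Tensor
  products suffice as test functions because they are closed under partial derivatives, approximate
  indicators of boxes, and reduce constancy to antiderivatives of one-dimensional bumps of mean
  zero.\<close>

lemma det_nat_eq: "det_nat n M = Determinant.det (Matrix.mat n n (\<lambda>(i,j). M i j))"
proof -
  have "\<sigma> i < n" if "\<sigma> permutes {..<n}" "i < n" for \<sigma> i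
    using permutes_in_image[OF that(1), of i] that(2) by auto
  thus ?thesis
    by (auto simp: det_nat_def Determinant.det_def atLeast0LessThan intro!: sum.cong prod.cong)
qed

lemma det_nat_cong:
  "(\<And>i j. i < n \<Longrightarrow> j < n \<Longrightarrow> M i j = M' i j) \<Longrightarrow> det_nat n M = det_nat n M'"
  unfolding det_nat_eq by (intro arg_cong[where f=Determinant.det] eq_matI) auto

lemma det_nat_one: "det_nat n (\<lambda>i j. if i = j then 1 else 0) = 1"
proof -
  have "Matrix.mat n n (\<lambda>(i,j). if i = j then 1 else 0) = (1\<^sub>m n :: real Matrix.mat)"
    by (intro eq_matI) auto
  thus ?thesis by (simp add: det_nat_eq)
qed

lemma det_nat_mult:
  "det_nat n (\<lambda>i j. \<Sum>c<n. M i c * M' c j) = det_nat n M * det_nat n M'"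
proof -
  let ?A = "Matrix.mat n n (\<lambda>(i,j). M i j)" and ?B = "Matrix.mat n n (\<lambda>(i,j). M' i j)"
  have "Matrix.mat n n (\<lambda>(i,j). \<Sum>c<n. M i c * M' c j) = ?A * ?B"
    by (intro eq_matI) (auto simp: scalar_prod_def atLeast0LessThan)
  thus ?thesis unfolding det_nat_eq by (subst det_mult[symmetric, of _ n]) auto
qed

lemma det_nat_smult: "det_nat n (\<lambda>i j. c * M i j) = c ^ n * det_nat n M"
  by (simp add: det_nat_def prod.distrib sum_distrib_left mult_ac)

lemma det_nat_permute_rows:
  assumes "\<sigma> permutes {..<n}"
  shows "det_nat n (\<lambda>i j. M (\<sigma> i) j) = of_int (sign \<sigma>) * det_nat n M"
proof -
  have lt: "\<sigma> i < n" if "i < n" for i using permutes_in_image[OF assms, of i] that by auto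
  have "Matrix.mat n n (\<lambda>(i,j). M (\<sigma> i) j) =
      Matrix.mat n n (\<lambda>(i,j). Matrix.mat n n (\<lambda>(i,j). M i j) $$ (\<sigma> i, j))"
    by (intro eq_matI) (auto simp: lt)
  thus ?thesis unfolding det_nat_eq using assms
    by (simp add: det_permute_rows[of _ n] atLeast0LessThan)
qed

lemma det_nat_transpose: "det_nat n (\<lambda>i j. M j i) = det_nat n M"
proof -
  have "Matrix.mat n n (\<lambda>(i,j). M j i) = transpose_mat (Matrix.mat n n (\<lambda>(i,j). M i j))"
    by (intro eq_matI) auto
  thus ?thesis unfolding det_nat_eq by (simp add: det_transpose[of _ n])
qed

lemma det_nat_permute_cols:
  assumes "\<sigma> permutes {..<n}"
  shows "det_nat n (\<lambda>i j. M i (\<sigma> j)) = of_int (sign \<sigma>) * det_nat n M"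
  using det_nat_permute_rows[OF assms, of "\<lambda>i j. M j i"]
  unfolding det_nat_transpose[of n "\<lambda>i j. M i (\<sigma> j)"] det_nat_transpose[of n M] .

lemma det_nat_identical_rows:
  assumes "i < n" "j < n" "i \<noteq> j" "\<And>c. M i c = M j c"
  shows "det_nat n M = 0"
  unfolding det_nat_eq using assms
  by (intro Determinant.det_identical_rows[of _ n i j] eq_vecI) (auto simp: Matrix.row_def)

text \<open>\<open>insert_index c\<close> enumerates the numbers other than \<open>c\<close> in
  increasing order, so the minor omits row \<open>b\<close> and column \<open>a\<close>: this is the
  transposed cofactor matrix.\<close>

definition adj_nat :: "nat \<Rightarrow> (nat \<Rightarrow> nat \<Rightarrow> real) \<Rightarrow> nat \<Rightarrow> nat \<Rightarrow> real" where
  "adj_nat n M a b =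
    (-1) ^ (a + b) * det_nat (n - 1) (\<lambda>i j. M (insert_index b i) (insert_index a j))"

lemma adj_nat_eq:
  assumes "a < n" "b < n"
  shows "adj_nat n M a b = adj_mat (Matrix.mat n n (\<lambda>(i,j). M i j)) $$ (a, b)"
proof -
  have "mat_delete (Matrix.mat n n (\<lambda>(i,j). M i j)) b a =
     Matrix.mat (n - 1) (n - 1) (\<lambda>(i,j). M (insert_index b i) (insert_index a j))"
    using assms by (intro eq_matI) (auto simp: mat_delete_def insert_index_def)
  thus ?thesis using assms
    by (simp add: adj_nat_def adj_mat_def Determinant.cofactor_def det_nat_eq add.commute)
qed

lemma adj_nat_mult:
  assumes "a < n" "b < n"
  shows "(\<Sum>c<n. adj_nat n M a c * M c b) = (if a = b then det_nat n M else 0)"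
proof -
  let ?A = "Matrix.mat n n (\<lambda>(i,j). M i j)"
  have "(\<Sum>c<n. adj_nat n M a c * M c b) = (adj_mat ?A * ?A) $$ (a,b)"
    using assms adj_mat(1)[of ?A n]
    by (auto simp: scalar_prod_def atLeast0LessThan adj_nat_eq intro!: sum.cong)
  also have "\<dots> = (if a = b then det_nat n M else 0)"
    using assms by (subst adj_mat(3)[of ?A n]) (auto simp: det_nat_eq)
  finally show ?thesis .
qed

lemma adj_nat_cong:
  assumes "\<And>i j. i < n \<Longrightarrow> j < n \<Longrightarrow> M i j = M' i j" "a < n" "b < n"
  shows "adj_nat n M a b = adj_nat n M' a b"
  using assms unfolding adj_nat_def
  by (intro arg_cong2[where f="(*)"] refl det_nat_cong) (auto simp: insert_index_def)

text \<open>Multiplying by the identity on the right reduces the claim to the adjugate identity, so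
  no minor has to be evaluated.\<close>

lemma adj_nat_one:
  assumes "a < n" "b < n"
  shows "adj_nat n (\<lambda>i j. if i = j then 1 else 0) a b = (if a = b then 1 else 0)"
proof -
  have "adj_nat n (\<lambda>i j. if i = j then 1 else 0) a b =
      (\<Sum>c<n. adj_nat n (\<lambda>i j. if i = j then 1 else 0) a c * (if c = b then 1 else 0))"
    using assms by (subst sum.mono_neutral_right[where S="{b}"]) auto
  also have "\<dots> = (if a = b then 1 else 0)"
    using assms by (subst adj_nat_mult) (auto simp: det_nat_one)
  finally show ?thesis .
qed

text \<open>Put D = det X and E = det Y. Multiplying Y X = D 1 by adj Y from the left gives E X = D
  adj Y; taking determinants of Y X = D 1 gives E D = D^(k+1). Here D can be cancelled, since D = 0
  would force X = 0 and then Y = 0.\<close>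

lemma recover_from_adj_nat:
  assumes Y: "\<And>a b. a < Suc k \<Longrightarrow> b < Suc k \<Longrightarrow> Y a b = adj_nat (Suc k) X a b"
    and nz: "det_nat (Suc k) Y \<noteq> 0" and k: "k > 0"
  shows "det_nat (Suc k) X ^ k = det_nat (Suc k) Y"
    and "a < Suc k \<Longrightarrow> b < Suc k \<Longrightarrow>
      X a b = det_nat (Suc k) X * adj_nat (Suc k) Y a b / det_nat (Suc k) Y"
proof -
  let ?n = "Suc k"
  let ?D = "det_nat ?n X" and ?E = "det_nat ?n Y"
  have YX: "(\<Sum>c<?n. Y a c * X c b) = (if a = b then ?D else 0)" if "a < ?n" "b < ?n" for a b
    unfolding adj_nat_mult[OF that, of X, symmetric]
    by (intro sum.cong refl arg_cong2[where f="(*)"] Y) (use that in auto)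
  have X: "X a b = ?D * adj_nat ?n Y a b / ?E" if ab: "a < ?n" "b < ?n" for a b
  proof -
    have "?E * X a b = (\<Sum>d<?n. (if a = d then ?E else 0) * X d b)"
      using ab by (subst sum.mono_neutral_right[where S="{a}"]) auto
    also have "\<dots> = (\<Sum>d<?n. (\<Sum>c<?n. adj_nat ?n Y a c * Y c d) * X d b)"
      by (intro sum.cong refl) (use ab in \<open>auto simp only: adj_nat_mult lessThan_iff\<close>)
    also have "\<dots> = (\<Sum>c<?n. adj_nat ?n Y a c * (\<Sum>d<?n. Y c d * X d b))"
      unfolding sum_distrib_left sum_distrib_right
      by (subst sum.swap) (simp add: mult.assoc)
    also have "\<dots> = (\<Sum>c<?n. adj_nat ?n Y a c * (if c = b then ?D else 0))"
      by (intro sum.cong refl) (use ab in \<open>auto simp only: YX lessThan_iff\<close>)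
    also have "\<dots> = ?D * adj_nat ?n Y a b"
      using ab by (subst sum.mono_neutral_right[where S="{b}"]) auto
    finally show ?thesis using nz by (simp add: field_simps)
  qed
  show "a < ?n \<Longrightarrow> b < ?n \<Longrightarrow> X a b = ?D * adj_nat ?n Y a b / ?E" by (rule X)
  have D0: "?D \<noteq> 0"
  proof
    assume "?D = 0"
    hence X0: "X a b = 0" if "a < ?n" "b < ?n" for a b using X[OF that] by simp
    have "Y a b = 0" if "a < ?n" "b < ?n" for a b
    proof -
      have "Y a b = adj_nat ?n (\<lambda>_ _. 0) a b" using that
        unfolding Y[OF that] by (intro adj_nat_cong) (simp_all only: X0)
      \<comment> \<open>For \<open>k > 0\<close> the minors of the zero matrix have positive size
        and vanish; a 1 by 1 matrix would have adjugate 1.\<close>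
      also have "\<dots> = 0" using k by (simp add: adj_nat_def det_nat_def power_0_left)
      finally show ?thesis .
    qed
    hence "?E = det_nat ?n (\<lambda>_ _. 0)" by (intro det_nat_cong) auto
    also have "\<dots> = 0" by (simp add: det_nat_def)
    finally show False using nz by simp
  qed
  have "?E * ?D = det_nat ?n (\<lambda>a b. \<Sum>c<?n. Y a c * X c b)" by (simp only: det_nat_mult)
  also have "\<dots> = det_nat ?n (\<lambda>a b. ?D * (if a = b then 1 else 0))"
    by (intro det_nat_cong) (simp add: YX del: sum.lessThan_Suc)
  also have "\<dots> = ?D ^ ?n" by (simp only: det_nat_smult det_nat_one)
  finally have "?E * ?D = ?D ^ k * ?D" by (simp only: power_Suc2)
  thus "?D ^ k = ?E" using D0 by (metis mult_right_cancel)
qed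

subsection \<open>Recovering a matrix from its exterior power\<close>

lemma bij_betw_kenum:
  fixes K :: "'n::finite set"
  assumes "card K = k"
  shows "bij_betw (kenum k K) {..<k} K"
proof -
  have "\<exists>e. bij_betw e {..<k} K"
    using ex_bij_betw_nat_finite[OF finite[of K]] assms by (auto simp: atLeast0LessThan)
  thus ?thesis unfolding kenum_def by (rule someI_ex)
qed

text \<open>The permutation of positions that turns the chosen enumeration \<open>kenum k K\<close>
  into \<open>e\<close>. It fixes all numbers from \<open>k\<close> on, as \<open>permutes\<close>
  demands.\<close>

definition enum_perm :: "nat \<Rightarrow> 'n set \<Rightarrow> (nat \<Rightarrow> 'n) \<Rightarrow> nat \<Rightarrow> nat" where
  "enum_perm k K e i = (if i < k then inv_into {..<k} (kenum k K) (e i) else i)"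

lemma enum_perm:
  fixes K :: "'n::finite set"
  assumes "card K = k" "bij_betw e {..<k} K"
  shows "enum_perm k K e permutes {..<k}"
    and "i < k \<Longrightarrow> kenum k K (enum_perm k K e i) = e i"
proof -
  note b = bij_betw_kenum[OF assms(1)]
  have "bij_betw (inv_into {..<k} (kenum k K) \<circ> e) {..<k} {..<k}"
    by (intro bij_betw_trans[OF assms(2)] bij_betw_inv_into b)
  hence "bij_betw (enum_perm k K e) {..<k} {..<k}"
    by (rule bij_betw_cong[THEN iffD1, rotated]) (auto simp: enum_perm_def)
  thus "enum_perm k K e permutes {..<k}"
    by (intro bij_imp_permutes) (auto simp: enum_perm_def)
  show "kenum k K (enum_perm k K e i) = e i" if "i < k"
    using that b assms(2)
    by (auto simp: enum_perm_def bij_betw_def intro!: f_inv_into_f)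
qed

definition enum_sign :: "nat \<Rightarrow> 'n set \<Rightarrow> (nat \<Rightarrow> 'n) \<Rightarrow> real" where
  "enum_sign k K e = of_int (sign (enum_perm k K e))"

text \<open>\<open>kenum\<close> orders different subsets independently of each other, so a minor
  taken in any other order agrees with an entry of \<open>ext_power\<close> only up to two
  reordering signs.\<close>

lemma minor_eq_ext_power:
  fixes X :: "real^'n^'n"
  assumes "card I = k" "bij_betw e {..<k} I" "card J = k" "bij_betw e' {..<k} J"
  shows "det_nat k (\<lambda>a b. X $ e a $ e' b) = enum_sign k I e * enum_sign k J e' * ext_power k X I J"
proof -
  have "det_nat k (\<lambda>a b. X $ e a $ e' b) =
    det_nat k (\<lambda>a b. X $ kenum k I (enum_perm k I e a) $ kenum k J (enum_perm k J e' b))"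
    using enum_perm(2)[OF assms(1,2)] enum_perm(2)[OF assms(3,4)] by (intro det_nat_cong) simp
  also have "\<dots> = enum_sign k I e *
     det_nat k (\<lambda>a b. X $ kenum k I a $ kenum k J (enum_perm k J e' b))"
    unfolding enum_sign_def by (rule det_nat_permute_rows[OF enum_perm(1)[OF assms(1,2)]])
  also have "det_nat k (\<lambda>a b. X $ kenum k I a $ kenum k J (enum_perm k J e' b)) =
     enum_sign k J e' * ext_power k X I J"
    unfolding enum_sign_def ext_power_def
    by (rule det_nat_permute_cols[OF enum_perm(1)[OF assms(3,4)]])
  finally show ?thesis by simp
qed

text \<open>Expanding the rows of the product yields a sum over maps \<open>g\<close> from positions
  to inner indices. A map that is not injective repeats a row of \<open>B\<close> and contributes
  nothing. The injective ones are grouped by their image \<open>K\<close>, where they differ from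
  \<open>kenum k K\<close> by a permutation, and the sum over permutations reassembles the minor of
  \<open>A\<close>.\<close>

lemma det_nat_Cauchy_Binet:
  fixes A B :: "real^'n^'n"
  shows "det_nat k (\<lambda>a b. (A ** B) $ e a $ e' b) =
    (\<Sum>K\<in>ksets k. det_nat k (\<lambda>a b. A $ e a $ kenum k K b) * det_nat k (\<lambda>a b. B $ kenum k K a $ e' b))"
proof -
  let ?P = "{..<k} \<rightarrow>\<^sub>E (UNIV::'n set)"
  let ?t = "\<lambda>g. (\<Prod>i<k. A $ e i $ g i) * det_nat k (\<lambda>i j. B $ g i $ e' j)"
  have "finite ?P" by (intro finite_PiE) auto
  hence fin: "finite {g. g \<in> ?P \<and> inj_on g {..<k}}" and fP: "finite ?P" by simp_all
  have im: "(\<lambda>g. g ` {..<k}) ` {g. g \<in> ?P \<and> inj_on g {..<k}} \<subseteq> ksets k"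
    by (simp add: ksets_def image_subset_iff card_image)
  have "det_nat k (\<lambda>a b. (A ** B) $ e a $ e' b) = (\<Sum>\<sigma> | \<sigma> permutes {..<k}.
      of_int (sign \<sigma>) * (\<Sum>g\<in>?P. \<Prod>i<k. A $ e i $ g i * B $ g i $ e' (\<sigma> i)))"
    unfolding det_nat_def matrix_matrix_mult_def by (simp add: prod_sum_PiE)
  also have "\<dots> = (\<Sum>g\<in>?P. ?t g)"
    unfolding det_nat_def sum_distrib_left
    by (subst sum.swap) (simp add: prod.distrib mult_ac)
  also have "\<dots> = (\<Sum>g | g \<in> ?P \<and> inj_on g {..<k}. ?t g)"
  proof (intro sum.mono_neutral_right fP ballI)
    fix g assume "g \<in> ?P - {g. g \<in> ?P \<and> inj_on g {..<k}}"
    then obtain i j where "i < k" "j < k" "i \<noteq> j" "g i = g j" by (auto simp: inj_on_def)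
    hence "det_nat k (\<lambda>i j. B $ g i $ e' j) = 0" by (intro det_nat_identical_rows[of i k j]) auto
    thus "?t g = 0" by simp
  qed auto
  also have "\<dots> = (\<Sum>K\<in>ksets k. \<Sum>g | g \<in> {g. g \<in> ?P \<and> inj_on g {..<k}} \<and> g ` {..<k} = K. ?t g)"
    by (rule sum.group[OF fin finite im, symmetric])
  also have "\<dots> = (\<Sum>K\<in>ksets k. det_nat k (\<lambda>a b. A $ e a $ kenum k K b) *
      det_nat k (\<lambda>a b. B $ kenum k K a $ e' b))"
  proof (intro sum.cong refl)
    fix K :: "'n set" assume "K \<in> ksets k"
    hence cK: "card K = k" by (simp add: ksets_def)
    note b = bij_betw_kenum[OF cK]
    have "(\<Sum>g | g \<in> {g. g \<in> ?P \<and> inj_on g {..<k}} \<and> g ` {..<k} = K. ?t g) =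
       (\<Sum>\<tau> | \<tau> permutes {..<k}. ?t (restrict (kenum k K \<circ> \<tau>) {..<k}))"
    \<comment> \<open>Composing \<open>kenum k K\<close> with a permutation and comparing with
      \<open>kenum k K\<close> are mutually inverse; \<open>restrict\<close> brings the composition
      back into the extensional maps \<open>?P\<close>.\<close>
    proof (rule sum.reindex_bij_witness[where j="enum_perm k K" and i="\<lambda>\<tau>. restrict (kenum k K \<circ> \<tau>) {..<k}"])
      fix g assume "g \<in> {g. g \<in> {g. g \<in> ?P \<and> inj_on g {..<k}} \<and> g ` {..<k} = K}"
      hence g: "g \<in> ?P" "bij_betw g {..<k} K" by (auto simp: bij_betw_def)
      show eq: "restrict (kenum k K \<circ> enum_perm k K g) {..<k} = g"
        using enum_perm(2)[OF cK g(2)] g(1) by (auto simp: fun_eq_iff PiE_def extensional_def)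
      show "enum_perm k K g \<in> {\<tau>. \<tau> permutes {..<k}}"
        using enum_perm(1)[OF cK g(2)] by simp
      show "?t (restrict (kenum k K \<circ> enum_perm k K g) {..<k}) = ?t g" unfolding eq ..
    next
      fix \<tau> assume "\<tau> \<in> {\<tau>. \<tau> permutes {..<k}}"
      hence \<tau>: "\<tau> permutes {..<k}" by simp
      have bb: "bij_betw (restrict (kenum k K \<circ> \<tau>) {..<k}) {..<k} K"
        using bij_betw_trans[OF permutes_imp_bij[OF \<tau>] b] by simp
      show "restrict (kenum k K \<circ> \<tau>) {..<k} \<in> {g. g \<in> {g. g \<in> ?P \<and> inj_on g {..<k}} \<and> g ` {..<k} = K}"
        using bb by (auto simp: bij_betw_def)
      have "\<tau> i < k" if "i < k" for i using permutes_in_image[OF \<tau>, of i] that by simp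
      moreover have "\<tau> i = i" if "\<not> i < k" for i using \<tau> that by (auto simp: permutes_def)
      ultimately show "enum_perm k K (restrict (kenum k K \<circ> \<tau>) {..<k}) = \<tau>"
        using b by (auto simp: enum_perm_def fun_eq_iff bij_betw_def inv_into_f_f)
    qed
    also have "\<dots> = (\<Sum>\<tau> | \<tau> permutes {..<k}. (\<Prod>i<k. A $ e i $ kenum k K (\<tau> i)) *
        (of_int (sign \<tau>) * det_nat k (\<lambda>i j. B $ kenum k K i $ e' j)))"
    proof (intro sum.cong refl, goal_cases)
      case (1 \<tau>)
      hence \<tau>: "\<tau> permutes {..<k}" by simp
      have "det_nat k (\<lambda>i j. B $ (restrict (kenum k K \<circ> \<tau>) {..<k}) i $ e' j) =
         det_nat k (\<lambda>i j. B $ kenum k K (\<tau> i) $ e' j)"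
        by (intro det_nat_cong) simp
      also have "\<dots> = of_int (sign \<tau>) * det_nat k (\<lambda>i j. B $ kenum k K i $ e' j)"
        by (rule det_nat_permute_rows[OF \<tau>])
      finally show ?case by simp
    qed
    also have "\<dots> = det_nat k (\<lambda>a b. A $ e a $ kenum k K b) * det_nat k (\<lambda>a b. B $ kenum k K a $ e' b)"
      unfolding det_nat_def[of k "\<lambda>a b. A $ e a $ kenum k K b"] sum_distrib_right
      by (simp add: mult_ac)
    finally show "(\<Sum>g | g \<in> {g. g \<in> ?P \<and> inj_on g {..<k}} \<and> g ` {..<k} = K. ?t g) = \<dots>" .
  qed
  finally show ?thesis .
qed

text \<open>Padding by the identity turns matrices indexed by \<open>ksets k\<close> into matrices indexed by a type,
  so that inverses and determinants from the library apply.\<close>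

definition pad :: "nat \<Rightarrow> ('n set \<Rightarrow> 'n set \<Rightarrow> real) \<Rightarrow> real^('n set)^('n::finite set)" where
  "pad k M = (\<chi> I J. if card I = k \<and> card J = k then M I J else if I = J then 1 else 0)"

lemma pad_cong: "(\<And>I J. I \<in> ksets k \<Longrightarrow> J \<in> ksets k \<Longrightarrow> M I J = N I J) \<Longrightarrow> pad k M = pad k N"
  by (auto simp: pad_def ksets_def vec_eq_iff)

text \<open>Padded matrices are block diagonal with an identity block outside
  \<open>ksets k\<close>, so the blocks multiply separately.\<close>

lemma pad_mult: "pad k M ** pad k N = pad k (\<lambda>I J. \<Sum>K\<in>ksets k. M I K * N K J)"
proof -
  have "(\<Sum>K\<in>UNIV. pad k M $ I $ K * pad k N $ K $ J) =
      pad k (\<lambda>I J. \<Sum>K\<in>ksets k. M I K * N K J) $ I $ J" for I J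
  proof (cases "card I = k")
    case True
    have "(\<Sum>K\<in>UNIV. pad k M $ I $ K * pad k N $ K $ J) =
        (\<Sum>K\<in>ksets k. pad k M $ I $ K * pad k N $ K $ J)"
      using True by (intro sum.mono_neutral_right) (auto simp: pad_def ksets_def)
    also have "\<dots> = pad k (\<lambda>I J. \<Sum>K\<in>ksets k. M I K * N K J) $ I $ J"
    proof (cases "card J = k")
      case False
      hence "pad k N $ K $ J = 0" if "K \<in> ksets k" for K using that by (auto simp: pad_def ksets_def)
      thus ?thesis using True False by (auto simp: pad_def)
    qed (use True in \<open>auto simp: pad_def ksets_def intro!: sum.cong\<close>)
    finally show ?thesis .
  next
    case False
    have "(\<Sum>K\<in>UNIV. pad k M $ I $ K * pad k N $ K $ J) =
        (\<Sum>K\<in>{I}. pad k M $ I $ K * pad k N $ K $ J)"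
      using False by (intro sum.mono_neutral_right) (auto simp: pad_def)
    thus ?thesis using False by (auto simp: pad_def)
  qed
  thus ?thesis by (simp add: matrix_matrix_mult_def vec_eq_iff)
qed

lemma pad_one: "pad k (\<lambda>I J. if I = J then 1 else 0) = mat 1"
  by (auto simp: pad_def mat_def vec_eq_iff)

lemma invertible_pad:
  assumes "invertible_on (ksets k) M"
  shows "invertible (pad k M)"
proof -
  obtain N where N: "\<forall>I\<in>ksets k. \<forall>J\<in>ksets k.
      (\<Sum>K\<in>ksets k. M I K * N K J) = (if I = J then 1 else 0) \<and>
      (\<Sum>K\<in>ksets k. N I K * M K J) = (if I = J then 1 else 0)"
    using assms unfolding invertible_on_def by blast
  have "pad k M ** pad k N = mat 1" "pad k N ** pad k M = mat 1"
    unfolding pad_mult pad_one[symmetric, of k] using N by (auto intro!: pad_cong)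
  thus ?thesis unfolding invertible_def by blast
qed

lemma pad_ext_power_mult:
  fixes A B :: "real^'n^'n"
  shows "pad k (ext_power k (A ** B)) = pad k (ext_power k A) ** pad k (ext_power k B)"
  unfolding pad_mult by (intro pad_cong) (simp add: ext_power_def det_nat_Cauchy_Binet)

lemma pad_ext_power_one: "pad k (ext_power k (mat 1 :: real^'n^'n)) = mat 1"
proof -
  have "ext_power k (mat 1 :: real^'n^'n) I J = (if I = J then 1 else 0)"
    if "I \<in> ksets k" "J \<in> ksets k" for I J
  proof (cases "I = J")
    case True
    have b: "bij_betw (kenum k J) {..<k} J" using that by (intro bij_betw_kenum) (simp add: ksets_def)
    have "ext_power k (mat 1 :: real^'n^'n) I J = det_nat k (\<lambda>a b. if a = b then 1 else 0)"
      unfolding ext_power_def True using b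
      by (intro det_nat_cong) (auto simp: mat_def bij_betw_def inj_on_def)
    thus ?thesis using True by (simp add: det_nat_one)
  next
    case False
    have bI: "bij_betw (kenum k I) {..<k} I" and bJ: "bij_betw (kenum k J) {..<k} J"
      using that by (auto intro: bij_betw_kenum simp: ksets_def)
    \<comment> \<open>Sets of equal size are not properly contained in each other; an index of
      \<open>I\<close> outside \<open>J\<close> gives a zero row in the minor.\<close>
    have "\<not> I \<subseteq> J" using False that card_subset_eq[of J I] by (auto simp: ksets_def)
    then obtain a where a: "a < k" "kenum k I a \<notin> J"
      using bI by (force simp: bij_betw_def)
    have "(\<Prod>i<k. (mat 1 :: real^'n^'n) $ kenum k I i $ kenum k J (\<sigma> i)) = 0"
      if "\<sigma> permutes {..<k}" for \<sigma>
    proof (intro prod_zero bexI)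
      have "kenum k J (\<sigma> a) \<in> J"
        using bJ permutes_in_image[OF that, of a] a(1) by (auto simp: bij_betw_def)
      thus "(mat 1 :: real^'n^'n) $ kenum k I a $ kenum k J (\<sigma> a) = 0"
        using a(2) by (auto simp: mat_def)
    qed (use a in auto)
    hence "ext_power k (mat 1 :: real^'n^'n) I J = 0"
      unfolding ext_power_def det_nat_def by (intro sum.neutral) simp
    thus ?thesis using False by simp
  qed
  hence "pad k (ext_power k (mat 1 :: real^'n^'n)) = pad k (\<lambda>I J. if I = J then 1 else 0)"
    by (intro pad_cong)
  thus ?thesis by (simp add: pad_one)
qed

text \<open>The adjugate of the submatrix \<open>B[I,I]\<close>, read off from \<open>X = \<Lambda>\<^sup>k B\<close> for \<open>card I = k + 1\<close>.\<close>

definition adj_of_pad :: "nat \<Rightarrow> 'n set \<Rightarrow> real^('n set)^('n::finite set) \<Rightarrow> nat \<Rightarrow> nat \<Rightarrow> real" where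
  "adj_of_pad k I X a b = (let e = kenum (Suc k) I; s = \<lambda>c. enum_sign k (I - {e c}) (e \<circ> insert_index c)
     in (-1) ^ (a + b) * (s b * s a) * X $ (I - {e b}) $ (I - {e a}))"

lemma bij_betw_insert_index: "b < Suc k \<Longrightarrow> bij_betw (insert_index b) {..<k} ({..<Suc k} - {b})"
  using insert_index_image[of b k] insert_index_inj_on[of b "{..<k}"]
  by (simp add: bij_betw_def atLeast0LessThan)

text \<open>Skipping position \<open>c\<close> in \<open>kenum (Suc k) I\<close> enumerates the
  smaller set, though not necessarily in its own \<open>kenum\<close> order. The signs in
  \<open>adj_of_pad\<close> compensate exactly for this.\<close>

lemma adj_of_pad_ext_power:
  fixes B :: "real^'n^'n"
  assumes I: "card I = Suc k" and ab: "a < Suc k" "b < Suc k"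
  shows "adj_of_pad k I (pad k (ext_power k B)) a b =
    adj_nat (Suc k) (\<lambda>i j. B $ kenum (Suc k) I i $ kenum (Suc k) I j) a b"
proof -
  let ?e = "kenum (Suc k) I"
  note be = bij_betw_kenum[OF I]
  have b: "bij_betw (?e \<circ> insert_index c) {..<k} (I - {?e c})" if "c < Suc k" for c
    using bij_betw_trans[OF bij_betw_insert_index[OF that] bij_betw_DiffI[OF be, of "{c}" "{?e c}"]] that be
    by (auto simp: bij_betw_def)
  have card: "card (I - {?e c}) = k" if "c < Suc k" for c
    using that be I by (subst card_Diff_singleton) (auto simp: bij_betw_def)
  show ?thesis
    using minor_eq_ext_power[OF card[OF ab(2)] b[OF ab(2)] card[OF ab(1)] b[OF ab(1)], of B]
    by (simp add: adj_of_pad_def adj_nat_def Let_def pad_def card ab)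
qed

lemma adj_of_pad_one:
  assumes I: "card I = Suc k" and ab: "a < Suc k" "b < Suc k"
  shows "adj_of_pad k (I::'n::finite set) (mat 1) a b = (if a = b then 1 else 0)"
proof -
  have "adj_of_pad k I (mat 1) a b =
      adj_nat (Suc k) (\<lambda>i j. (mat 1 :: real^'n^'n) $ kenum (Suc k) I i $ kenum (Suc k) I j) a b"
    using adj_of_pad_ext_power[OF assms, of "mat 1"] by (simp add: pad_ext_power_one)
  also have "\<dots> = adj_nat (Suc k) (\<lambda>i j. if i = j then 1 else 0) a b"
    using bij_betw_kenum[OF I] ab
    by (intro adj_nat_cong) (auto simp: mat_def bij_betw_def inj_on_def)
  also have "\<dots> = (if a = b then 1 else 0)" using ab by (rule adj_nat_one)
  finally show ?thesis .
qed

text \<open>On \<open>\<Lambda>\<^sup>k B\<close> this is the determinant of the adjugate of B[I,I],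
  that is, the \<open>k\<close>-th power of det B[I,I].\<close>

definition det_pad :: "nat \<Rightarrow> 'n set \<Rightarrow> real^('n set)^('n::finite set) \<Rightarrow> real" where
  "det_pad k I X = det_nat (Suc k) (adj_of_pad k I X)"

text \<open>The recovery formula is D adj(Y) / E with \<open>D^k = E\<close>. Taking the positive
  root D = E^(1/k) produces the exponent \<open>1 / k - 1\<close>.\<close>

definition entry_pad :: "nat \<Rightarrow> 'n set \<Rightarrow> real^('n set)^('n::finite set) \<Rightarrow> nat \<Rightarrow> nat \<Rightarrow> real" where
  "entry_pad k I X a b = adj_nat (Suc k) (adj_of_pad k I X) a b * det_pad k I X powr (1 / k - 1)"

lemma det_pad_one: "card I = Suc k \<Longrightarrow> det_pad k (I::'n::finite set) (mat 1) = 1"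
  unfolding det_pad_def
  by (rule trans[OF det_nat_cong det_nat_one]) (simp add: adj_of_pad_one)

lemma entry_pad_one:
  assumes "card I = Suc k" "a < Suc k" "b < Suc k"
  shows "entry_pad k (I::'n::finite set) (mat 1) a b = (if a = b then 1 else 0)"
proof -
  have "adj_nat (Suc k) (adj_of_pad k I (mat 1)) a b = adj_nat (Suc k) (\<lambda>i j. if i = j then 1 else 0) a b"
    using assms by (intro adj_nat_cong) (simp_all add: adj_of_pad_one)
  thus ?thesis using assms by (simp add: entry_pad_def det_pad_one adj_nat_one)
qed

text \<open>The sign \<open>s\<close> is that of det B[I,I], of which the exterior power reveals
  only the \<open>k\<close>-th power; for odd \<open>k\<close> a positive power forces a positive
  base.\<close>

lemma entry_pad_ext_power:
  fixes B :: "real^'n^'n"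
  assumes I: "card I = Suc k" and k: "k > 0" and pos: "det_pad k I (pad k (ext_power k B)) > 0"
  obtains s :: real where "s = 1 \<or> s = -1" "odd k \<Longrightarrow> s = 1"
    "\<And>a b. a < Suc k \<Longrightarrow> b < Suc k \<Longrightarrow> B $ kenum (Suc k) I a $ kenum (Suc k) I b =
       s * entry_pad k I (pad k (ext_power k B)) a b"
proof -
  define X where "X = (\<lambda>i j. B $ kenum (Suc k) I i $ kenum (Suc k) I j)"
  define Y where "Y = adj_of_pad k I (pad k (ext_power k B))"
  define D where "D = det_nat (Suc k) X"
  define E where "E = det_nat (Suc k) Y"
  have E: "E > 0" using pos by (simp add: E_def Y_def det_pad_def)
  have YX: "Y a b = adj_nat (Suc k) X a b" if "a < Suc k" "b < Suc k" for a b
    unfolding Y_def X_def using adj_of_pad_ext_power[OF I that] .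
  have nz: "det_nat (Suc k) Y \<noteq> 0" using E by (simp add: E_def)
  have Dk: "D ^ k = E"
    unfolding D_def E_def by (rule recover_from_adj_nat(1)[OF YX nz k])
  have ent: "X a b = D * adj_nat (Suc k) Y a b / E" if "a < Suc k" "b < Suc k" for a b
    unfolding D_def E_def by (rule recover_from_adj_nat(2)[OF YX nz k that])
  have D0: "D \<noteq> 0" using Dk E k by (auto simp: power_0_left)
  have "\<bar>D\<bar> ^ k = E" using Dk E by (metis abs_of_pos power_abs)
  hence "\<bar>D\<bar> = E powr (1 / k)"
    using D0 k by (metis powr_realpow powr_powr zero_less_abs_iff powr_one abs_ge_zero
      nonzero_mult_div_cancel_left of_nat_0_less_iff less_irrefl times_divide_eq_right mult.right_neutral)
  hence D: "D = sgn D * E powr (1 / k)" by (metis sgn_mult_abs)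
  show ?thesis
  proof
    show "sgn D = 1 \<or> sgn D = -1" using D0 by (auto simp: sgn_if)
    have "0 < D ^ k" using Dk E by simp
    thus "sgn D = 1" if "odd k" using that k by (auto simp: zero_less_power_eq)
    fix a b assume ab: "a < Suc k" "b < Suc k"
    have "E powr (1 / k) / E = E powr (1 / k - 1)" using E by (simp add: powr_diff)
    hence "D / E = sgn D * E powr (1 / k - 1)"
      using arg_cong[OF D, of "\<lambda>z. z / E"] by (simp only: times_divide_eq_right[symmetric])
    hence "D / E * adj_nat (Suc k) Y a b = sgn D * (adj_nat (Suc k) Y a b * E powr (1 / k - 1))"
      by simp
    hence "D * adj_nat (Suc k) Y a b / E = sgn D * (adj_nat (Suc k) Y a b * E powr (1 / k - 1))"
      by (simp only: times_divide_eq_left)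
    thus "B $ kenum (Suc k) I a $ kenum (Suc k) I b =
       sgn D * entry_pad k I (pad k (ext_power k B)) a b"
      using ent[OF ab] by (simp add: X_def entry_pad_def det_pad_def E_def Y_def)
  qed
qed

text \<open>If \<open>v\<close> is in the kernel and v_i is nonzero, add \<open>v / v_i\<close> to
  column \<open>i\<close> of the identity to get \<open>B\<close>. Then A B = A, so cancelling the
  invertible exterior power of \<open>A\<close> gives \<open>\<Lambda>\<^sup>k B = 1\<close>.
  Recovery now says that B_ii is 1 or -1, whereas B_ii = 2 by construction.\<close>

lemma invertible_if_ext_power:
  fixes A :: "real^'n^'n"
  assumes k: "k > 0" "Suc k \<le> CARD('n)" and inv: "invertible (pad k (ext_power k A))"
  shows "invertible A"
proof (rule ccontr)
  assume "\<not> invertible A"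
  then obtain v where v: "A *v v = 0" "v \<noteq> 0"
    by (metis invertible_left_inverse matrix_left_invertible_ker)
  then obtain i where i: "v $ i \<noteq> 0" by (auto simp: vec_eq_iff)
  obtain I where I: "card I = Suc k" "{i} \<subseteq> I"
    using exists_subset_between[of "{i}" "Suc k" UNIV] k by auto
  define B :: "real^'n^'n" where "B = mat 1 + (\<chi> r c. if c = i then v $ r / v $ i else 0)"
  have "A ** (\<chi> r c. if c = i then v $ r / v $ i else 0) = 0"
  proof -
    have "(\<Sum>l\<in>UNIV. A $ r $ l * (if c = i then v $ l / v $ i else 0)) = 0" for r c
    proof -
      have "(\<Sum>l\<in>UNIV. A $ r $ l * v $ l) = 0"
        using v(1) by (simp add: matrix_vector_mult_def vec_eq_iff)
      hence "(\<Sum>l\<in>UNIV. A $ r $ l * (v $ l / v $ i)) = 0"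
        by (simp add: sum_divide_distrib[symmetric])
      thus ?thesis by (cases "c = i") simp_all
    qed
    thus ?thesis by (simp add: matrix_matrix_mult_def vec_eq_iff)
  qed
  hence "A ** B = A" by (simp add: B_def matrix_add_ldistrib)
  hence "pad k (ext_power k A) ** pad k (ext_power k B) = pad k (ext_power k A)"
    by (metis pad_ext_power_mult)
  hence EB: "pad k (ext_power k B) = mat 1"
    using inv by (metis invertible_def matrix_mul_assoc matrix_mul_lid)
  obtain a where a: "a < Suc k" "kenum (Suc k) I a = i"
    using bij_betw_kenum[OF I(1)] I(2) unfolding bij_betw_def by (metis imageE insert_subset lessThan_iff)
  have "det_pad k I (pad k (ext_power k B)) > 0" using det_pad_one[OF I(1)] EB by simp
  from entry_pad_ext_power[OF I(1) k(1) this] obtain s :: real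
    where "s = 1 \<or> s = -1" "B $ i $ i = s * entry_pad k I (mat 1) a a"
    using a EB by metis
  hence "B $ i $ i = 1 \<or> B $ i $ i = -1" using entry_pad_one[OF I(1) a(1) a(1)] by auto
  thus False using i by (simp add: B_def mat_def)
qed

text \<open>The entry at (i, j) is read off from a principal submatrix containing both indices.
  Fixing one such index set per pair makes the reconstruction a function of the exterior power
  alone.\<close>

definition pair_set :: "nat \<Rightarrow> 'n \<Rightarrow> 'n \<Rightarrow> 'n set" where
  "pair_set k i j = (SOME I. card I = Suc k \<and> i \<in> I \<and> j \<in> I)"

lemma pair_set:
  assumes "k > 0" "Suc k \<le> CARD('n::finite)"
  shows "card (pair_set k i j) = Suc k" "i \<in> pair_set k i j" "j \<in> pair_set k i (j::'n)"
proof -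
  have "card {i,j} \<le> Suc k" using assms by (simp add: card_insert_if)
  hence "\<exists>I. card I = Suc k \<and> i \<in> I \<and> j \<in> I"
    using exists_subset_between[of "{i,j}" "Suc k" UNIV] assms by auto
  from someI_ex[OF this] show "card (pair_set k i j) = Suc k" "i \<in> pair_set k i j" "j \<in> pair_set k i j"
    by (auto simp: pair_set_def)
qed

definition enum_index :: "nat \<Rightarrow> 'n set \<Rightarrow> 'n \<Rightarrow> nat" where
  "enum_index k I i = inv_into {..<Suc k} (kenum (Suc k) I) i"

lemma enum_index:
  assumes "card (I::'n::finite set) = Suc k" "i \<in> I"
  shows "enum_index k I i < Suc k" "kenum (Suc k) I (enum_index k I i) = i"
  using bij_betw_kenum[OF assms(1)] assms(2)
    inv_into_into[of i "kenum (Suc k) I" "{..<Suc k}"] f_inv_into_f[of i "kenum (Suc k) I" "{..<Suc k}"]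
  by (auto simp: enum_index_def bij_betw_def)

text \<open>Under \<open>near_one\<close> this selects, from \<open>B\<close> and \<open>-B\<close>,
  the matrix with positive diagonal.\<close>

definition root_pad :: "nat \<Rightarrow> real^('n set)^('n::finite set) \<Rightarrow> real^'n^'n" where
  "root_pad k X = (\<chi> i j. let I = pair_set k i j in entry_pad k I X (enum_index k I i) (enum_index k I j))"

text \<open>Each clause has its own purpose: \<open>det_pad > 0\<close> permits the real root,
  positive diagonal entries make the signs of different \<open>I\<close> comparable, and the
  positive determinant later fixes the sign in odd dimension.\<close>

definition near_one :: "nat \<Rightarrow> real^('n set)^('n::finite set) \<Rightarrow> bool" where
  "near_one k X \<longleftrightarrow> (\<forall>I. card I = Suc k \<longrightarrow> det_pad k I X > 0 \<and> (\<forall>a<Suc k. entry_pad k I X a a > 0)) \<and>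
     det (root_pad k X) > 0"

text \<open>Since the recovered diagonal is positive, the sign obtained for \<open>I\<close> equals
  the sign of B_ii for every \<open>i\<close> in \<open>I\<close>. Overlapping index sets therefore
  carry the same sign.\<close>

lemma root_pad_ext_power:
  fixes B :: "real^'n^'n"
  assumes k: "k > 0" "Suc k \<le> CARD('n)" and near: "near_one k (pad k (ext_power k B))"
  obtains s :: real where "s = 1 \<or> s = -1" "odd k \<Longrightarrow> s = 1" "B = s *\<^sub>R root_pad k (pad k (ext_power k B))"
proof -
  let ?X = "pad k (ext_power k B)"
  have *: "\<exists>s::real. (s = 1 \<or> s = -1) \<and> (odd k \<longrightarrow> s = 1) \<and> (\<forall>i\<in>I. s = sgn (B $ i $ i)) \<and>
     (\<forall>i\<in>I. \<forall>j\<in>I. B $ i $ j = s * entry_pad k I ?X (enum_index k I i) (enum_index k I j))"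
    if I: "card I = Suc k" for I
  proof -
    have pos: "det_pad k I ?X > 0" "\<And>a. a < Suc k \<Longrightarrow> entry_pad k I ?X a a > 0"
      using near I by (auto simp: near_one_def)
    obtain s :: real where s: "s = 1 \<or> s = -1" "odd k \<Longrightarrow> s = 1"
      "\<And>a b. a < Suc k \<Longrightarrow> b < Suc k \<Longrightarrow> B $ kenum (Suc k) I a $ kenum (Suc k) I b =
       s * entry_pad k I ?X a b"
      using entry_pad_ext_power[OF I k(1) pos(1)] by metis
    have e: "B $ i $ j = s * entry_pad k I ?X (enum_index k I i) (enum_index k I j)"
      if "i \<in> I" "j \<in> I" for i j
      using s(3)[of "enum_index k I i" "enum_index k I j"] enum_index[OF I that(1)] enum_index[OF I that(2)]
      by simp
    have "s = sgn (B $ i $ i)" if "i \<in> I" for i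
      using e[OF that that] pos(2)[OF enum_index(1)[OF I that]] s(1) by (auto simp: sgn_mult)
    thus ?thesis using s(1,2) e by blast
  qed
  \<comment> \<open>An arbitrary reference index: \<open>pair_set k i0 i\<close> ties its sign to
    that of every other \<open>i\<close>.\<close>
  fix i0 :: 'n
  define s where "s = sgn (B $ i0 $ i0)"
  have diag: "sgn (B $ i $ i) = s" for i
    using *[OF pair_set(1)[OF k, of i0 i]] pair_set(2,3)[OF k] unfolding s_def by metis
  have s: "s = 1 \<or> s = -1" "odd k \<Longrightarrow> s = 1"
    using *[OF pair_set(1)[OF k, of i0 i0]] pair_set(2)[OF k] unfolding s_def by metis+
  have "B $ i $ j = s * root_pad k ?X $ i $ j" for i j
  proof -
    let ?I = "pair_set k i j"
    obtain s' :: real where s': "\<forall>i\<in>?I. s' = sgn (B $ i $ i)"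
      "\<forall>i\<in>?I. \<forall>j\<in>?I. B $ i $ j = s' * entry_pad k ?I ?X (enum_index k ?I i) (enum_index k ?I j)"
      using *[OF pair_set(1)[OF k, of i j]] by blast
    have "s' = s" using s'(1) pair_set(2)[OF k, of i j] diag[of i] by simp
    moreover have "B $ i $ j = s' * entry_pad k ?I ?X (enum_index k ?I i) (enum_index k ?I j)"
      using s'(2) pair_set(2,3)[OF k, where i=i and j=j] by blast
    ultimately show ?thesis by (simp add: root_pad_def Let_def)
  qed
  hence "B = s *\<^sub>R root_pad k ?X" by (simp add: vec_eq_iff)
  thus ?thesis using that s by blast
qed

lemma root_pad_one:
  assumes k: "k > 0" "Suc k \<le> CARD('n)"
  shows "root_pad k (mat 1) = (mat 1 :: real^'n^'n)"
proof -
  have "root_pad k (mat 1) $ i $ j = (mat 1 :: real^'n^'n) $ i $ j" for i j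
  proof -
    note p = pair_set[OF k, where i=i and j=j]
    note e = enum_index[OF p(1,2)] enum_index[OF p(1,3)]
    have "enum_index k (pair_set k i j) i = enum_index k (pair_set k i j) j \<longleftrightarrow> i = j"
      using e(2,4) by metis
    moreover have "(mat 1 :: real^'n^'n) $ i $ j = (if i = j then 1 else 0)" by (simp add: mat_def)
    ultimately show ?thesis
      by (simp add: root_pad_def Let_def entry_pad_one[OF p(1) e(1) e(3)])
  qed
  thus ?thesis by (simp add: vec_eq_iff)
qed

section \<open>Continuity of the reconstruction and of matrix inversion\<close>

lemma tendsto_det_nat:
  "(\<And>i j. i < n \<Longrightarrow> j < n \<Longrightarrow> ((\<lambda>x. M x i j) \<longlongrightarrow> L i j) F) \<Longrightarrow> ((\<lambda>x. det_nat n (M x)) \<longlongrightarrow> det_nat n L) F"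
  unfolding det_nat_def
  by (intro tendsto_sum tendsto_mult tendsto_const tendsto_prod) (auto dest: permutes_in_image)

lemma tendsto_adj_of_pad:
  "(X \<longlongrightarrow> Z) F \<Longrightarrow> ((\<lambda>x. adj_of_pad k I (X x) a b) \<longlongrightarrow> adj_of_pad k I Z a b) F"
  unfolding adj_of_pad_def Let_def by (intro tendsto_intros)

lemma tendsto_det_pad: "(X \<longlongrightarrow> Z) F \<Longrightarrow> ((\<lambda>x. det_pad k I (X x)) \<longlongrightarrow> det_pad k I Z) F"
  unfolding det_pad_def by (intro tendsto_det_nat tendsto_adj_of_pad)

lemma tendsto_entry_pad:
  assumes "(X \<longlongrightarrow> Z) F" "det_pad k I Z \<noteq> 0"
  shows "((\<lambda>x. entry_pad k I (X x) a b) \<longlongrightarrow> entry_pad k I Z a b) F"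
  unfolding entry_pad_def adj_nat_def
  by (intro tendsto_mult tendsto_const tendsto_det_nat tendsto_adj_of_pad tendsto_powr tendsto_det_pad assms)

lemma tendsto_det:
  fixes M :: "'a \<Rightarrow> real^'n^'n"
  assumes "\<And>i j. ((\<lambda>x. M x $ i $ j) \<longlongrightarrow> L $ i $ j) F"
  shows "((\<lambda>x. det (M x)) \<longlongrightarrow> det L) F"
  unfolding det_def by (intro tendsto_sum tendsto_mult[OF tendsto_const] tendsto_prod assms)

text \<open>At the identity the determinants and diagonal entries in question all equal 1, and only
  finitely many index sets are involved, so positivity persists nearby.\<close>

lemma eventually_near_one:
  fixes X :: "'a \<Rightarrow> real^('n set)^('n::finite set)"
  assumes k: "k > 0" "Suc k \<le> CARD('n)" and X: "(X \<longlongrightarrow> mat 1) F"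
  shows "eventually (\<lambda>x. near_one k (X x)) F"
proof -
  have 1: "eventually (\<lambda>x. \<forall>I\<in>{I::'n set. card I = Suc k}. det_pad k I (X x) > 0) F"
    by (intro eventually_ball_finite ballI order_tendstoD(1)[OF tendsto_det_pad[OF X]])
      (auto simp: det_pad_one)
  have 2: "eventually (\<lambda>x. \<forall>I\<in>{I::'n set. card I = Suc k}. \<forall>a\<in>{..<Suc k}. entry_pad k I (X x) a a > 0) F"
    by (intro eventually_ball_finite ballI order_tendstoD(1)[OF tendsto_entry_pad[OF X]])
      (auto simp: det_pad_one entry_pad_one)
  have r: "((\<lambda>x. root_pad k (X x) $ i $ j) \<longlongrightarrow> root_pad k (mat 1) $ i $ j) F" for i j
    by (auto simp: root_pad_def Let_def det_pad_one[OF pair_set(1)[OF k]] intro!: tendsto_entry_pad[OF X])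
  have "((\<lambda>x. det (root_pad k (X x))) \<longlongrightarrow>
      det (root_pad k (mat 1 :: real^('n set)^('n set)))) F"
    by (intro tendsto_det r)
  hence 3: "eventually (\<lambda>x. det (root_pad k (X x)) > 0) F"
    by (rule order_tendstoD(1)) (simp add: root_pad_one[OF k] det_I)
  show ?thesis using 1 2 3 by eventually_elim (simp add: near_one_def)
qed

lemma matrix_inv:
  fixes A :: "real^'n^'n"
  assumes "invertible A"
  shows "A ** matrix_inv A = mat 1" "matrix_inv A ** A = mat 1"
  using someI_ex[of "\<lambda>A'. A ** A' = mat 1 \<and> A' ** A = mat 1"] assms
  by (auto simp: invertible_def matrix_inv_def)

text \<open>Cramer's rule presents the inverse as quotients of determinants, from which its
  continuity can be read off entrywise.\<close>

lemma matrix_inv_cramer: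
  fixes A :: "real^'n^'n"
  assumes "det A \<noteq> 0"
  shows "matrix_inv A $ i $ j = det (\<chi> r c. if c = i then axis j 1 $ r else A $ r $ c) / det A"
proof -
  have "A *v (matrix_inv A *v axis j 1) = axis j 1"
    using assms by (simp add: matrix_vector_mul_assoc matrix_inv invertible_det_nz)
  hence "matrix_inv A *v axis j 1 = (\<chi> k. det (\<chi> r c. if c = k then axis j 1 $ r else A $ r $ c) / det A)"
    using cramer[OF assms] by blast
  thus ?thesis by (simp add: matrix_vector_mult_basis column_def vec_eq_iff)
qed

lemma tendsto_matrix_inv:
  fixes X :: "'a \<Rightarrow> real^'n^'n"
  assumes X: "(X \<longlongrightarrow> Z) F" and Z: "invertible Z"
  shows "((\<lambda>x. matrix_inv (X x)) \<longlongrightarrow> matrix_inv Z) F"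
proof -
  have dZ: "det Z \<noteq> 0" using Z by (simp add: invertible_det_nz)
  have d: "((\<lambda>x. det (X x)) \<longlongrightarrow> det Z) F" by (intro tendsto_det tendsto_intros X)
  have "((\<lambda>x. matrix_inv (X x) $ i $ j) \<longlongrightarrow> matrix_inv Z $ i $ j) F" for i j
  proof -
    have e: "eventually (\<lambda>x. det (\<chi> r c. if c = i then axis j 1 $ r else X x $ r $ c) / det (X x) =
        matrix_inv (X x) $ i $ j) F"
      using tendsto_imp_eventually_ne[OF d dZ] by eventually_elim (simp add: matrix_inv_cramer)
    have "((\<lambda>x. det (\<chi> r c. if c = i then axis j 1 $ r else X x $ r $ c) / det (X x)) \<longlongrightarrow>
        det (\<chi> r c. if c = i then axis j 1 $ r else Z $ r $ c) / det Z) F"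
    proof (intro tendsto_divide d dZ)
      show "((\<lambda>x. det (\<chi> r c. if c = i then axis j 1 $ r else X x $ r $ c)) \<longlongrightarrow>
        det (\<chi> r c. if c = i then axis j 1 $ r else Z $ r $ c)) F"
        by (rule tendsto_det) (auto intro!: tendsto_intros X)
    qed
    thus ?thesis unfolding matrix_inv_cramer[OF dZ] by (rule Lim_transform_eventually[OF _ e])
  qed
  thus ?thesis by (intro vec_tendstoI)
qed

subsection \<open>Smooth functions\<close>

lemma Ck_on_cong:
  fixes g h :: "'a::euclidean_space \<Rightarrow> 'b::euclidean_space"
  assumes U: "open U"
  shows "Ck_on n U g \<Longrightarrow> (\<And>x. x \<in> U \<Longrightarrow> g x = h x) \<Longrightarrow> Ck_on n U h"
proof (induction n arbitrary: g h)
  case 0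
  thus ?case by (simp cong: continuous_on_cong)
next
  case (Suc n)
  have gd: "g differentiable (at x)" if "x \<in> U" for x
    using Suc.prems(1) that U by (auto simp: differentiable_on_eq_differentiable_at)
  have "frechet_derivative g (at x) = frechet_derivative h (at x)" if "x \<in> U" for x
    by (rule frechet_derivative_transform_within_open[OF gd[OF that] U that]) (simp add: Suc.prems)
  hence "Ck_on n U (\<lambda>x. frechet_derivative h (at x) v)" for v
    using Suc.IH[of "\<lambda>x. frechet_derivative g (at x) v" "\<lambda>x. frechet_derivative h (at x) v"] Suc.prems(1)
    by auto
  moreover have "h differentiable_on U"
    using Suc.prems by (auto simp: differentiable_on_def intro: differentiable_transform_within[where d=1])
  ultimately show ?case by simp
qed

text \<open>Allows any explicit derivative in place of the chosen \<open>frechet_derivative\<close>;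
  the closure properties below are inductions through this rule.\<close>

lemma Ck_on_SucI:
  fixes g :: "'a::euclidean_space \<Rightarrow> 'b::euclidean_space"
  assumes U: "open U" and der: "\<And>x. x \<in> U \<Longrightarrow> (g has_derivative g' x) (at x)"
    and Ck: "\<And>v. Ck_on n U (\<lambda>x. g' x v)"
  shows "Ck_on (Suc n) U g"
proof -
  have "g differentiable_on U"
    using der U by (auto simp: differentiable_on_eq_differentiable_at differentiable_def)
  moreover have "Ck_on n U (\<lambda>x. frechet_derivative g (at x) v)" for v
    by (rule Ck_on_cong[OF U Ck[of v]]) (use frechet_derivative_at[OF der] in auto)
  ultimately show ?thesis by simp
qed

lemma Ck_on_SucD:
  assumes "Ck_on (Suc n) U g" "open U" "x \<in> U"
  shows "(g has_derivative frechet_derivative g (at x)) (at x)"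
  using assms by (auto simp: differentiable_on_eq_differentiable_at frechet_derivative_works)

lemma Ck_on_Suc_imp: "Ck_on (Suc n) U g \<Longrightarrow> Ck_on n U g"
proof (induction n arbitrary: g)
  case 0
  thus ?case by (auto intro: differentiable_imp_continuous_on)
qed auto

lemma smooth_on_has_derivative:
  "smooth_on U g \<Longrightarrow> open U \<Longrightarrow> x \<in> U \<Longrightarrow> (g has_derivative frechet_derivative g (at x)) (at x)"
  unfolding smooth_on_def using Ck_on_SucD[of 0] by blast

lemma smooth_on_frechet_derivative:
  "smooth_on U g \<Longrightarrow> smooth_on U (\<lambda>x. frechet_derivative g (at x) v)"
  unfolding smooth_on_def by (metis Ck_on.simps(2))

lemma smooth_on_imp_continuous_on: "smooth_on U g \<Longrightarrow> continuous_on U g"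
  unfolding smooth_on_def by (metis Ck_on.simps(1))

lemma smooth_onI_derivative:
  assumes U: "open U" and der: "\<And>x. x \<in> U \<Longrightarrow> (g has_derivative g' x) (at x)"
    and smooth: "\<And>v. smooth_on U (\<lambda>x. g' x v)"
  shows "smooth_on U g"
  unfolding smooth_on_def
proof
  show "Ck_on n U g" for n
  proof (cases n)
    case 0
    thus ?thesis using der U
      by (auto simp: continuous_on_eq_continuous_at intro: has_derivative_continuous)
  next
    case (Suc m)
    have "Ck_on m U (\<lambda>x. g' x v)" for v using smooth[of v] by (simp add: smooth_on_def)
    with U der show ?thesis unfolding Suc by (rule Ck_on_SucI)
  qed
qed

lemma Ck_on_const: "Ck_on n U (\<lambda>_. c)"
proof (induction n arbitrary: c)
  case (Suc n)
  thus ?case by (simp add: frechet_derivative_const)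
qed simp

lemma Ck_on_add: "open U \<Longrightarrow> Ck_on n U f \<Longrightarrow> Ck_on n U g \<Longrightarrow> Ck_on n U (\<lambda>x. f x + g x)"
proof (induction n arbitrary: f g)
  case (Suc n)
  show ?case using Suc.prems(1)
  proof (rule Ck_on_SucI)
    show "((\<lambda>x. f x + g x) has_derivative
        (\<lambda>v. frechet_derivative f (at x) v + frechet_derivative g (at x) v)) (at x)" if "x \<in> U" for x
      using Suc.prems that by (intro has_derivative_add Ck_on_SucD)
    show "Ck_on n U (\<lambda>x. frechet_derivative f (at x) v + frechet_derivative g (at x) v)" for v
      using Suc.prems by (intro Suc.IH) auto
  qed
qed (auto intro: continuous_intros)

lemma Ck_on_mult:
  fixes f g :: "'a::euclidean_space \<Rightarrow> real"
  shows "open U \<Longrightarrow> Ck_on n U f \<Longrightarrow> Ck_on n U g \<Longrightarrow> Ck_on n U (\<lambda>x. f x * g x)"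
proof (induction n arbitrary: f g)
  case (Suc n)
  show ?case using Suc.prems(1)
  proof (rule Ck_on_SucI)
    show "((\<lambda>x. f x * g x) has_derivative
        (\<lambda>v. f x * frechet_derivative g (at x) v + frechet_derivative f (at x) v * g x)) (at x)"
      if "x \<in> U" for x
      using Suc.prems that by (intro has_derivative_mult Ck_on_SucD)
    show "Ck_on n U (\<lambda>x. f x * frechet_derivative g (at x) v + frechet_derivative f (at x) v * g x)" for v
      using Suc.prems Ck_on_Suc_imp[OF Suc.prems(2)] Ck_on_Suc_imp[OF Suc.prems(3)]
      by (intro Ck_on_add Suc.IH) auto
  qed
qed (auto intro: continuous_intros)

text \<open>The induction generalises over the exponent, because each differentiation lowers it by
  one and multiplies by a derivative of \<open>f\<close>.\<close>

lemma Ck_on_powr: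
  fixes f :: "'a::euclidean_space \<Rightarrow> real"
  shows "open U \<Longrightarrow> Ck_on n U f \<Longrightarrow> (\<And>x. x \<in> U \<Longrightarrow> f x > 0) \<Longrightarrow> Ck_on n U (\<lambda>x. f x powr a)"
proof (induction n arbitrary: f a)
  case 0
  hence "\<forall>x\<in>U. f x \<noteq> 0" by force
  thus ?case using 0 by (auto intro!: continuous_intros)
next
  case (Suc n)
  show ?case using Suc.prems(1)
  proof (rule Ck_on_SucI)
    fix x assume x: "x \<in> U"
    have "((\<lambda>x. f x powr a) has_derivative
        (\<lambda>v. f x powr a * (0 * ln (f x) + frechet_derivative f (at x) v * a / f x))) (at x)"
      using has_derivative_powr[OF Ck_on_SucD[OF Suc.prems(2,1) x] has_derivative_const Suc.prems(3)[OF x] UNIV_I, of a]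
      by simp
    moreover have "f x powr a * (0 * ln (f x) + w * a / f x) = a * f x powr (a - 1) * w" for w
      using Suc.prems(3)[OF x] by (simp add: powr_diff mult_ac)
    ultimately show "((\<lambda>x. f x powr a) has_derivative
        (\<lambda>v. a * f x powr (a - 1) * frechet_derivative f (at x) v)) (at x)" by simp
  next
    show "Ck_on n U (\<lambda>x. a * f x powr (a - 1) * frechet_derivative f (at x) v)" for v
      using Suc.prems Ck_on_Suc_imp[OF Suc.prems(2)]
      by (intro Ck_on_mult Ck_on_const Suc.IH) auto
  qed
qed

text \<open>An affine inner map has constant derivative, so differentiating gives a directional
  derivative of \<open>g\<close> in the fixed direction \<open>L v\<close>, composed with the same
  map; the induction hypothesis applies to it directly.\<close>

lemma Ck_on_affine:
  fixes g :: "'b::euclidean_space \<Rightarrow> 'c::euclidean_space" and L :: "'a::euclidean_space \<Rightarrow> 'b"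
  assumes L: "bounded_linear L"
  shows "Ck_on n UNIV g \<Longrightarrow> Ck_on n UNIV (\<lambda>x. g (L x + c))"
proof (induction n arbitrary: g)
  case 0
  have "continuous_on UNIV (\<lambda>x. L x + c)"
    using L by (intro continuous_intros linear_continuous_on) auto
  thus ?case using 0 by (auto intro: continuous_on_compose2)
next
  case (Suc n)
  show ?case using open_UNIV
  proof (rule Ck_on_SucI)
    fix x
    have "((\<lambda>x. L x + c) has_derivative L) (at x)"
      using has_derivative_add[OF bounded_linear_imp_has_derivative[OF L] has_derivative_const] by simp
    from diff_chain_at[OF this Ck_on_SucD[OF Suc.prems open_UNIV UNIV_I]]
    show "((\<lambda>x. g (L x + c)) has_derivative (\<lambda>v. frechet_derivative g (at (L x + c)) (L v))) (at x)"
      by (simp add: o_def)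
  next
    show "Ck_on n UNIV (\<lambda>x. frechet_derivative g (at (L x + c)) (L v))" for v
      using Suc.prems by (intro Suc.IH[of "\<lambda>y. frechet_derivative g (at y) (L v)"]) auto
  qed
qed

lemma Ck_on_subset: "open V \<Longrightarrow> V \<subseteq> U \<Longrightarrow> Ck_on n U g \<Longrightarrow> Ck_on n V g"
  by (induction n arbitrary: g) (auto intro: continuous_on_subset differentiable_on_subset)

lemma Ck_on_local:
  fixes g :: "'a::euclidean_space \<Rightarrow> 'b::euclidean_space"
  assumes "\<And>x. x \<in> U \<Longrightarrow> \<exists>V. open V \<and> x \<in> V \<and> Ck_on n V g" and U: "open U"
  shows "Ck_on n U g"
  using assms(1)
proof (induction n arbitrary: g)
  case 0
  thus ?case using U by (fastforce simp: continuous_on_eq_continuous_at)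
next
  case (Suc n)
  have "g differentiable (at x)" if "x \<in> U" for x
    using Suc.prems[OF that] by (auto simp: differentiable_on_eq_differentiable_at)
  moreover have "Ck_on n U (\<lambda>x. frechet_derivative g (at x) v)" for v
    using Suc.prems by (intro Suc.IH) auto
  ultimately show ?case using U by (auto simp: differentiable_on_eq_differentiable_at)
qed

lemma Ck_on_vec:
  fixes g :: "'a::euclidean_space \<Rightarrow> real^'n"
  shows "open U \<Longrightarrow> (\<And>i. Ck_on n U (\<lambda>x. g x $ i)) \<Longrightarrow> Ck_on n U g"
proof (induction n arbitrary: g)
  case 0
  thus ?case using continuous_on_vec_lambda[of U "\<lambda>i x. g x $ i"] by simp
next
  case (Suc n)
  show ?case using Suc.prems(1)
  proof (rule Ck_on_SucI)
    fix x assume x: "x \<in> U"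
    have "((\<lambda>x. g x $ i) has_derivative (\<lambda>v. (\<chi> i. frechet_derivative (\<lambda>x. g x $ i) (at x) v) $ i)) (at x)" for i
      using Ck_on_SucD[OF Suc.prems(2) Suc.prems(1) x, of i] by simp
    thus "(g has_derivative (\<lambda>v. \<chi> i. frechet_derivative (\<lambda>x. g x $ i) (at x) v)) (at x)"
      by (subst has_derivative_componentwise_within) (auto simp: Basis_vec_def inner_axis)
  next
    show "Ck_on n U (\<lambda>x. \<chi> i. frechet_derivative (\<lambda>x. g x $ i) (at x) v)" for v
      using Suc.prems by (intro Suc.IH) auto
  qed
qed

lemma smooth_on_const: "smooth_on U (\<lambda>_. c)"
  and smooth_on_add: "open U \<Longrightarrow> smooth_on U f \<Longrightarrow> smooth_on U g \<Longrightarrow> smooth_on U (\<lambda>x. f x + g x)"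
  and smooth_on_subset: "open V \<Longrightarrow> V \<subseteq> U \<Longrightarrow> smooth_on U f \<Longrightarrow> smooth_on V f"
  and smooth_on_cong: "open U \<Longrightarrow> smooth_on U f \<Longrightarrow> (\<And>x. x \<in> U \<Longrightarrow> f x = g x) \<Longrightarrow> smooth_on U g"
  by (auto simp: smooth_on_def intro: Ck_on_const Ck_on_add Ck_on_subset Ck_on_cong)

lemma smooth_on_mult:
  fixes f g :: "'a::euclidean_space \<Rightarrow> real"
  shows "open U \<Longrightarrow> smooth_on U f \<Longrightarrow> smooth_on U g \<Longrightarrow> smooth_on U (\<lambda>x. f x * g x)"
  by (auto simp: smooth_on_def intro: Ck_on_mult)

lemma smooth_on_powr:
  fixes f :: "'a::euclidean_space \<Rightarrow> real"
  shows "open U \<Longrightarrow> smooth_on U f \<Longrightarrow> (\<And>x. x \<in> U \<Longrightarrow> f x > 0) \<Longrightarrow> smooth_on U (\<lambda>x. f x powr a)"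
  by (auto simp: smooth_on_def intro: Ck_on_powr)

lemma smooth_on_affine:
  fixes g :: "'b::euclidean_space \<Rightarrow> 'c::euclidean_space" and L :: "'a::euclidean_space \<Rightarrow> 'b"
  shows "bounded_linear L \<Longrightarrow> smooth_on UNIV g \<Longrightarrow> smooth_on UNIV (\<lambda>x. g (L x + c))"
  by (auto simp: smooth_on_def intro: Ck_on_affine)

lemma smooth_on_local:
  fixes g :: "'a::euclidean_space \<Rightarrow> 'b::euclidean_space"
  assumes "\<And>x. x \<in> U \<Longrightarrow> \<exists>V. open V \<and> x \<in> V \<and> smooth_on V g" "open U"
  shows "smooth_on U g"
  unfolding smooth_on_def
proof
  show "Ck_on n U g" for n
    by (rule Ck_on_local[OF _ assms(2)]) (use assms(1) in \<open>auto simp: smooth_on_def\<close>)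
qed

lemma smooth_on_vec:
  fixes g :: "'a::euclidean_space \<Rightarrow> real^'n"
  shows "open U \<Longrightarrow> (\<And>i. smooth_on U (\<lambda>x. g x $ i)) \<Longrightarrow> smooth_on U g"
  by (auto simp: smooth_on_def intro: Ck_on_vec)

lemma smooth_on_sum:
  assumes "open U" "\<And>i. i \<in> A \<Longrightarrow> smooth_on U (f i)"
  shows "smooth_on U (\<lambda>x. \<Sum>i\<in>A. f i x)"
  using assms(2)
  by (induction A rule: infinite_finite_induct) (auto intro: smooth_on_const smooth_on_add[OF assms(1)])

lemma smooth_on_prod:
  fixes f :: "'i \<Rightarrow> 'a::euclidean_space \<Rightarrow> real"
  assumes "open U" "\<And>i. i \<in> A \<Longrightarrow> smooth_on U (f i)"
  shows "smooth_on U (\<lambda>x. \<Prod>i\<in>A. f i x)"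
  using assms(2)
  by (induction A rule: infinite_finite_induct) (auto intro: smooth_on_const smooth_on_mult[OF assms(1)])

subsection \<open>Tensor products of bump functions\<close>

text \<open>The classical function exp(-1/t) with an additional factor t^(-m). With these factors
  the linear span of the family is closed under differentiation, which turns smoothness into an
  induction over all \<open>m\<close> at once.\<close>

definition flat :: "nat \<Rightarrow> real \<Rightarrow> real" where
  "flat m t = (if t > 0 then inverse t ^ m * exp (- inverse t) else 0)"

lemma flat_tendsto_0: "((\<lambda>t. flat m t) \<longlongrightarrow> 0) (at 0)"
proof -
  have "((\<lambda>t::real. inverse t ^ m / exp (inverse t)) \<longlongrightarrow> 0) (at_right 0)"
    by (rule filterlim_compose[OF tendsto_power_div_exp_0 filterlim_inverse_at_top_right])
  hence "((\<lambda>t. flat m t) \<longlongrightarrow> 0) (at_right 0)"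
    by (rule Lim_transform_eventually)
      (auto simp: flat_def eventually_at_filter exp_minus divide_inverse)
  moreover have "((\<lambda>t. flat m t) \<longlongrightarrow> 0) (at_left 0)"
    by (rule Lim_transform_eventually[OF tendsto_const]) (auto simp: flat_def eventually_at_filter)
  ultimately show ?thesis by (simp add: filterlim_split_at_real)
qed

lemma flat_has_derivative:
  "(flat m has_real_derivative (flat (m + 2) t - m * flat (m + 1) t)) (at t)"
proof (cases t "0::real" rule: linorder_cases)
  case less
  have "((\<lambda>_. 0) has_real_derivative (flat (m + 2) t - m * flat (m + 1) t)) (at t)"
    using less by (simp add: flat_def)
  thus ?thesis
    by (rule DERIV_cong_ev[THEN iffD1, OF refl _ refl, rotated])
      (use less in \<open>auto simp: flat_def eventually_nhds intro!: exI[of _ "{..<0}"]\<close>)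
next
  case equal
  \<comment> \<open>The difference quotient of \<open>flat m\<close> at 0 is
    \<open>flat (m + 1)\<close>, which tends to 0.\<close>
  have "((\<lambda>h. (flat m (0 + h) - flat m 0) / h) \<longlongrightarrow> 0) (at 0)"
    by (rule Lim_transform_eventually[OF flat_tendsto_0[of "m + 1"]])
      (auto simp: flat_def eventually_at_filter divide_inverse mult_ac)
  thus ?thesis using equal by (simp add: flat_def DERIV_def)
next
  case greater
  have "((\<lambda>t. inverse t ^ m * exp (- inverse t)) has_real_derivative (flat (m + 2) t - m * flat (m + 1) t)) (at t)"
  proof (rule DERIV_cong)
    show "((\<lambda>t. inverse t ^ m * exp (- inverse t)) has_real_derivative
      m * (inverse t ^ (m - 1) * - (inverse t * inverse t)) * exp (- inverse t) +
      inverse t ^ m * (exp (- inverse t) * (inverse t * inverse t))) (at t)"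
      using greater by (auto intro!: derivative_eq_intros)
    \<comment> \<open>The truncated exponent at \<open>m = 0\<close> does no harm, since its
      coefficient is 0.\<close>
    have "real m * (inverse t ^ (m - 1) * - (inverse t * inverse t)) = - (m * inverse t ^ (m + 1))"
      by (cases m) simp_all
    thus "m * (inverse t ^ (m - 1) * - (inverse t * inverse t)) * exp (- inverse t) +
      inverse t ^ m * (exp (- inverse t) * (inverse t * inverse t)) = flat (m + 2) t - m * flat (m + 1) t"
      using greater by (simp add: flat_def power_add power2_eq_square)
  qed
  thus ?thesis
    by (rule DERIV_cong_ev[THEN iffD1, OF refl _ refl, rotated])
      (use greater in \<open>auto simp: flat_def eventually_nhds intro!: exI[of _ "{0<..}"]\<close>)
qed

lemma Ck_on_flat: "Ck_on n UNIV (flat m)"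
proof (induction n arbitrary: m)
  case 0
  thus ?case
    using flat_has_derivative by (auto simp: continuous_on_eq_continuous_at intro: DERIV_isCont)
next
  case (Suc n)
  show ?case using open_UNIV
  proof (rule Ck_on_SucI)
    show "(flat m has_derivative (\<lambda>v. (flat (m + 2) t + (- real m) * flat (m + 1) t) * v)) (at t)" for t
      using flat_has_derivative[of m t] by (simp add: has_field_derivative_def)
    show "Ck_on n UNIV (\<lambda>t. (flat (m + 2) t + (- real m) * flat (m + 1) t) * v)" for v
      by (intro Ck_on_add Ck_on_mult Ck_on_const Suc.IH open_UNIV)
  qed
qed

lemma smooth_on_flat: "smooth_on UNIV (flat m)"
  by (simp add: smooth_on_def Ck_on_flat)

lemma flat_0_bounds: "0 \<le> flat 0 t" "flat 0 t \<le> 1" "flat 0 t > 0 \<longleftrightarrow> t > 0"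
  by (auto simp: flat_def)

text \<open>No sign condition is imposed, so derivatives and linear combinations of bumps are again
  bumps.\<close>

definition bump :: "real \<Rightarrow> real \<Rightarrow> (real \<Rightarrow> real) \<Rightarrow> bool" where
  "bump a b \<psi> \<longleftrightarrow> smooth_on UNIV \<psi> \<and> (\<forall>t. t \<notin> {a..b} \<longrightarrow> \<psi> t = 0)"

lemma bump_has_derivative:
  assumes "bump a b \<psi>"
  shows "(\<psi> has_real_derivative deriv \<psi> t) (at t)"
proof -
  have "\<psi> differentiable (at t)"
    using smooth_on_has_derivative[of UNIV \<psi> t] assms by (auto simp: bump_def differentiable_def)
  thus ?thesis by (simp add: DERIV_deriv_iff_real_differentiable)
qed

lemma bump_deriv:
  assumes "bump a b \<psi>"
  shows "bump a b (deriv \<psi>)"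
proof -
  have "frechet_derivative \<psi> (at t) 1 = deriv \<psi> t" for t
    using frechet_derivative_at[OF bump_has_derivative[OF assms, of t, unfolded has_field_derivative_def]]
    by (metis mult.right_neutral)
  hence "smooth_on UNIV (deriv \<psi>)"
    using smooth_on_frechet_derivative[of UNIV \<psi> 1] assms by (simp add: bump_def)
  moreover have "deriv \<psi> t = 0" if "t \<notin> {a..b}" for t
  proof -
    have "((\<lambda>_. 0) has_real_derivative 0) (at t)" by simp
    hence "(\<psi> has_real_derivative 0) (at t)"
      by (rule DERIV_cong_ev[THEN iffD1, OF refl _ refl, rotated])
        (use that assms in \<open>auto simp: bump_def eventually_nhds intro!: exI[of _ "- {a..b}"]\<close>)
    thus ?thesis by (rule DERIV_imp_deriv)
  qed
  ultimately show ?thesis by (auto simp: bump_def)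
qed

lemma bump_combine:
  assumes "bump a b \<phi>" "bump a b \<psi>"
  shows "bump a b (\<lambda>t. \<phi> t + c * \<psi> t)"
  using assms by (auto simp: bump_def intro!: smooth_on_add smooth_on_mult smooth_on_const)

text \<open>Steepening both ends as \<open>m\<close> grows gives smooth functions with values in
  [0,1] that tend pointwise to the indicator of the open interval. If \<open>b \<le> a\<close> they
  vanish identically, so empty intervals need no separate treatment.\<close>

definition plateau :: "real \<Rightarrow> real \<Rightarrow> nat \<Rightarrow> real \<Rightarrow> real" where
  "plateau a b m t = flat 0 (real (Suc m) * (t - a)) * flat 0 (real (Suc m) * (b - t))"

lemma plateau_bounds: "0 \<le> plateau a b m t" "plateau a b m t \<le> 1" "plateau a b m t > 0 \<longleftrightarrow> a < t \<and> t < b"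
  using flat_0_bounds[of "real (Suc m) * (t - a)"] flat_0_bounds[of "real (Suc m) * (b - t)"]
  unfolding plateau_def by (auto simp: mult_le_one zero_less_mult_iff)

lemma bump_plateau:
  assumes "a' \<le> a" "b \<le> b'"
  shows "bump a' b' (plateau a b m)"
proof -
  have "smooth_on UNIV (\<lambda>t. flat 0 (real (Suc m) * t + (- real (Suc m) * a)))"
    "smooth_on UNIV (\<lambda>t. flat 0 ((- real (Suc m)) * t + real (Suc m) * b))"
    by (rule smooth_on_affine[OF bounded_linear_mult_right smooth_on_flat])+
  from smooth_on_mult[OF open_UNIV this] have "smooth_on UNIV (plateau a b m)"
    by (rule smooth_on_cong[OF open_UNIV]) (simp add: plateau_def algebra_simps)
  thus ?thesis using assms plateau_bounds[of a b m]
    by (auto simp: bump_def) (metis dual_order.strict_trans1 less_eq_real_def not_le order_less_le)+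
qed

lemma plateau_tendsto: "(\<lambda>m. plateau a b m t) \<longlonglongrightarrow> indicator {a<..<b} t"
proof -
  have lim: "(\<lambda>m. flat 0 (real (Suc m) * s)) \<longlonglongrightarrow> 1" if "s > 0" for s
  proof -
    have "(\<lambda>m. exp (- (inverse (real (Suc m)) * inverse s))) \<longlonglongrightarrow> exp (- (0 * inverse s))"
      by (intro tendsto_intros LIMSEQ_inverse_real_of_nat)
    thus ?thesis using that by (simp add: flat_def)
  qed
  show ?thesis
  proof (cases "a < t \<and> t < b")
    case True
    thus ?thesis unfolding plateau_def using tendsto_mult[OF lim[of "t - a"] lim[of "b - t"]] by simp
  next
    case False
    hence "plateau a b m t = 0" for m using plateau_bounds[of a b m t] by auto
    thus ?thesis using False by simp
  qed
qed

lemma bump_integrable: "bump a b \<psi> \<Longrightarrow> \<psi> integrable_on {c..d}"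
  by (intro integrable_continuous_interval continuous_on_subset[OF smooth_on_imp_continuous_on[of UNIV \<psi>]])
    (auto simp: bump_def)

lemma bump_normalized:
  assumes "a < b"
  obtains \<eta> where "bump a b \<eta>" "integral {a..b} \<eta> = 1" "\<And>t. \<eta> t \<ge> 0" "\<And>t. a < t \<Longrightarrow> t < b \<Longrightarrow> \<eta> t > 0"
proof -
  let ?p = "plateau a b 0"
  have p: "bump a b ?p" by (rule bump_plateau) auto
  have "integral {a..b} ?p \<noteq> 0"
  proof
    assume "integral {a..b} ?p = 0"
    moreover have "continuous_on {a..b} ?p"
      using p by (auto simp: bump_def intro: continuous_on_subset dest: smooth_on_imp_continuous_on)
    ultimately have "?p ((a + b) / 2) = 0"
      using integral_eq_0_iff[of a b ?p] plateau_bounds(1)[of a b 0] assms by auto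
    thus False using plateau_bounds(3)[of a b 0 "(a + b) / 2"] assms by auto
  qed
  moreover have "integral {a..b} ?p \<ge> 0"
    by (intro integral_nonneg bump_integrable[OF p] plateau_bounds)
  ultimately have pos: "integral {a..b} ?p > 0" by simp
  show ?thesis
  proof
    \<comment> \<open>The zero summand brings a mere rescaling into the form of
      \<open>bump_combine\<close>.\<close>
    have "bump a b (\<lambda>t. 0 * ?p t + (1 / integral {a..b} ?p) * ?p t)"
      using p by (intro bump_combine) (auto simp: bump_def smooth_on_const)
    thus "bump a b (\<lambda>t. (1 / integral {a..b} ?p) * ?p t)" by simp
    show "integral {a..b} (\<lambda>t. (1 / integral {a..b} ?p) * ?p t) = 1"
      using pos by (subst integral_mult_right) simp
  qed (use pos plateau_bounds[of a b 0] in auto)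
qed

text \<open>A primitive vanishing to the left of the support is constant to its right, with value
  the total integral; mean zero is what makes it a bump again.\<close>

lemma bump_antiderivative:
  assumes \<psi>: "bump a b \<psi>" and int: "integral {a..b} \<psi> = 0" and ab: "a < b"
  obtains \<Psi> where "bump a b \<Psi>" "deriv \<Psi> = \<psi>"
proof -
  \<comment> \<open>Starting strictly to the left of \<open>a\<close> makes every
    \<open>t \<ge> a\<close> an interior point, so the one-sided fundamental theorem yields a
    two-sided derivative.\<close>
  define \<Psi> where "\<Psi> t = integral {a - 1..t} \<psi>" for t
  have low: "\<Psi> t = 0" if "t < a" for t
  proof -
    have "\<Psi> t = integral {a - 1..t} (\<lambda>_. 0)"
      unfolding \<Psi>_def using that \<psi> by (intro integral_cong) (auto simp: bump_def)
    thus ?thesis by simp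
  qed
  have ext: "integral {a - 1..a} \<psi> = 0"
  proof -
    \<comment> \<open>\<open>bump\<close> prescribes no value at the endpoint \<open>a\<close>
      itself, so this single point is discarded as negligible.\<close>
    have "integral {a - 1..a} \<psi> = integral {a - 1..a} (\<lambda>_. 0)"
      using \<psi> by (intro integral_spike[of "{a}"]) (auto simp: bump_def)
    thus ?thesis by simp
  qed
  have high: "\<Psi> t = 0" if "t > b" for t
  proof -
    have "\<Psi> t = integral {a - 1..a} \<psi> + (integral {a..b} \<psi> + integral {b..t} \<psi>)"
      unfolding \<Psi>_def using that ab bump_integrable[OF \<psi>]
      by (simp add: Henstock_Kurzweil_Integration.integral_combine)
    moreover have "integral {b..t} \<psi> = integral {b..t} (\<lambda>_. 0)"
      using \<psi> by (intro integral_spike[of "{b}"]) (auto simp: bump_def)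
    ultimately show ?thesis using ext int by simp
  qed
  have der: "(\<Psi> has_real_derivative \<psi> t) (at t)" for t
  proof (cases "t < a")
    case True
    have "((\<lambda>_. 0) has_real_derivative \<psi> t) (at t)" using True \<psi> by (simp add: bump_def)
    thus ?thesis
      by (rule DERIV_cong_ev[THEN iffD1, OF refl _ refl, rotated])
        (use True low in \<open>auto simp: eventually_nhds intro!: exI[of _ "{..<a}"]\<close>)
  next
    case False
    have "continuous_on {a - 1..t + 1} \<psi>"
      using \<psi> by (auto simp: bump_def intro: continuous_on_subset dest: smooth_on_imp_continuous_on)
    hence "(\<Psi> has_real_derivative \<psi> t) (at t within {a - 1..t + 1})"
      unfolding \<Psi>_def using False by (intro integral_has_real_derivative) auto
    thus ?thesis using False at_within_Icc_at[of "a - 1" t "t + 1"] by simp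
  qed
  have "smooth_on UNIV \<Psi>"
  proof (rule smooth_onI_derivative[OF open_UNIV])
    show "(\<Psi> has_derivative (\<lambda>v. \<psi> t * v)) (at t)" for t
      using der[of t] by (simp add: has_field_derivative_def)
    show "smooth_on UNIV (\<lambda>t. \<psi> t * v)" for v
      using \<psi> by (auto simp: bump_def intro!: smooth_on_mult smooth_on_const)
  qed
  hence "bump a b \<Psi>" using low high by (auto simp: bump_def not_le)
  moreover have "deriv \<Psi> = \<psi>" using der by (auto intro: DERIV_imp_deriv)
  ultimately show ?thesis using that by blast
qed

section \<open>Products of one-dimensional bumps and their partial derivatives\<close>

definition tensor :: "('n \<Rightarrow> real \<Rightarrow> real) \<Rightarrow> real^'n \<Rightarrow> real" where
  "tensor \<psi> x = (\<Prod>i\<in>UNIV. \<psi> i (x $ i))"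

lemma tensor_upd: "tensor (\<psi>(j := \<phi>)) x = \<phi> (x $ j) * (\<Prod>i\<in>UNIV - {j}. \<psi> i (x $ i))"
  unfolding tensor_def by (subst prod.remove[of _ j]) (auto intro!: prod.cong)

definition bumps :: "real^'n \<Rightarrow> real^'n \<Rightarrow> ('n \<Rightarrow> real \<Rightarrow> real) \<Rightarrow> bool" where
  "bumps a b \<psi> \<longleftrightarrow> (\<forall>i. bump (a $ i) (b $ i) (\<psi> i))"

lemma bumps_upd: "bumps a b \<psi> \<Longrightarrow> bump (a $ j) (b $ j) \<phi> \<Longrightarrow> bumps a b (\<psi>(j := \<phi>))"
  by (simp add: bumps_def)

lemma bumpsD: "bumps a b \<psi> \<Longrightarrow> bump (a $ j) (b $ j) (\<psi> j)"
  by (simp add: bumps_def)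

lemma smooth_on_tensor:
  fixes a :: "real^'n"
  assumes "bumps a b \<psi>"
  shows "smooth_on UNIV (tensor \<psi>)"
proof -
  have "smooth_on UNIV (\<lambda>x::real^'n. \<psi> i (x $ i + 0))" for i
    using assms by (intro smooth_on_affine bounded_linear_vec_nth) (simp add: bumps_def bump_def)
  from smooth_on_prod[OF open_UNIV this, where A=UNIV] show ?thesis
    by (rule smooth_on_cong[OF open_UNIV]) (simp add: tensor_def)
qed

lemma tensor_eq_0: "bumps a b \<psi> \<Longrightarrow> x \<notin> cbox a b \<Longrightarrow> tensor \<psi> x = 0"
  by (auto simp: tensor_def bumps_def bump_def mem_box_cart)

text \<open>Along a line in direction \<open>j\<close> only the \<open>j\<close>-th factor varies,
  so a partial derivative of a tensor product is again a tensor product.\<close>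

lemma tensor_has_partial:
  assumes "bumps a b \<psi>"
  shows "frechet_derivative (tensor \<psi>) (at x) (axis j 1) = tensor (\<psi>(j := deriv (\<psi> j))) x"
proof -
  have "(tensor \<psi> has_derivative frechet_derivative (tensor \<psi>) (at x)) (at x)"
    by (rule smooth_on_has_derivative[OF smooth_on_tensor[OF assms]]) auto
  hence D: "(tensor \<psi> has_derivative frechet_derivative (tensor \<psi>) (at x)) (at (x + 0 *\<^sub>R axis j 1))"
    and lin: "linear (frechet_derivative (tensor \<psi>) (at x))"
    by (auto intro: has_derivative_linear)
  have "((\<lambda>t. x + t *\<^sub>R axis j 1) has_derivative (\<lambda>t. t *\<^sub>R axis j (1::real))) (at (0::real))"
    by (auto intro!: derivative_eq_intros)
  from diff_chain_at[OF this D] have "((\<lambda>t. tensor \<psi> (x + t *\<^sub>R axis j 1)) has_derivative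
      (\<lambda>t. frechet_derivative (tensor \<psi>) (at x) (t *\<^sub>R axis j 1))) (at 0)"
    by (simp only: o_def)
  moreover have "(\<lambda>t. frechet_derivative (tensor \<psi>) (at x) (t *\<^sub>R axis j 1)) =
      (*) (frechet_derivative (tensor \<psi>) (at x) (axis j 1))"
    using lin by (auto simp: linear_cmul)
  ultimately have 1: "((\<lambda>t. tensor \<psi> (x + t *\<^sub>R axis j 1)) has_real_derivative
      frechet_derivative (tensor \<psi>) (at x) (axis j 1)) (at 0)"
    by (simp only: has_field_derivative_def)
  have eq: "tensor \<psi> (x + t *\<^sub>R axis j 1) = \<psi> j (x $ j + t) * (\<Prod>i\<in>UNIV - {j}. \<psi> i (x $ i))" for t
    using tensor_upd[of \<psi> j "\<psi> j" "x + t *\<^sub>R axis j 1"] by (simp add: axis_def)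
  have "((\<lambda>t. \<psi> j (x $ j + t)) has_real_derivative deriv (\<psi> j) (x $ j)) (at 0)"
    using bump_has_derivative[OF bumpsD[OF assms, of j], of "x $ j"] DERIV_shift[of "\<psi> j" _ 0 "x $ j"]
    by (simp add: add.commute)
  hence 2: "((\<lambda>t. tensor \<psi> (x + t *\<^sub>R axis j 1)) has_real_derivative tensor (\<psi>(j := deriv (\<psi> j))) x) (at 0)"
    unfolding eq tensor_upd by (rule DERIV_cmult_right)
  show ?thesis using DERIV_unique[OF 1 2] .
qed

lemma test_fun_tensor:
  assumes "bumps a b \<psi>" "cbox a b \<subseteq> \<Omega>"
  shows "test_fun \<Omega> (tensor \<psi>)"
proof -
  have "closure {x. tensor \<psi> x \<noteq> 0} \<subseteq> cbox a b"
    using tensor_eq_0[OF assms(1)] by (intro closure_minimal closed_cbox) auto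
  moreover from this have "compact (closure {x. tensor \<psi> x \<noteq> 0})"
    unfolding compact_eq_bounded_closed using bounded_subset[OF bounded_cbox] by blast
  ultimately show ?thesis
    using assms(2) smooth_on_tensor[OF assms(1)] unfolding test_fun_def by blast
qed

subsection \<open>Functions with smooth weak gradient\<close>

lemma integrable_mult_bounded_continuous:
  fixes w T :: "real^'n \<Rightarrow> real"
  assumes w: "integrable lebesgue w" and T: "continuous_on UNIV T" "\<And>x. \<bar>T x\<bar> \<le> C"
  shows "integrable lebesgue (\<lambda>x. w x * T x)"
proof (rule Bochner_Integration.integrable_bound)
  show "integrable lebesgue (\<lambda>x. C * \<bar>w x\<bar>)" using w by auto
  have "T \<in> borel_measurable lborel" using T(1) by (simp add: borel_measurable_continuous_onI)
  hence "T \<in> borel_measurable lebesgue" by (rule measurable_completion)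
  thus "(\<lambda>x. w x * T x) \<in> borel_measurable lebesgue" using w by measurable
  have "\<bar>T x\<bar> * \<bar>w x\<bar> \<le> \<bar>C\<bar> * \<bar>w x\<bar>" for x
    using T(2)[of x] by (intro mult_right_mono) linarith+
  thus "AE x in lebesgue. norm (w x * T x) \<le> norm (C * \<bar>w x\<bar>)" by (simp add: abs_mult mult.commute)
qed

lemma tensor_continuous: "bumps a b \<psi> \<Longrightarrow> continuous_on UNIV (tensor \<psi>)"
  by (rule smooth_on_imp_continuous_on[OF smooth_on_tensor])

lemma continuous_bounded_cbox:
  fixes T :: "real^'n \<Rightarrow> real"
  assumes T: "continuous_on (cbox a b) T" and z: "\<And>x. x \<notin> cbox a b \<Longrightarrow> T x = 0"
  obtains C where "C \<ge> 0" "\<And>x. \<bar>T x\<bar> \<le> C"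
proof -
  have "bounded (T ` cbox a b)" by (intro compact_imp_bounded compact_continuous_image T compact_cbox)
  then obtain C where C: "\<And>x. x \<in> cbox a b \<Longrightarrow> norm (T x) \<le> C" unfolding bounded_iff by auto
  have "\<bar>T x\<bar> \<le> \<bar>C\<bar>" for x using C[of x] z[of x] by (cases "x \<in> cbox a b") auto
  thus ?thesis using that[of "\<bar>C\<bar>"] by auto
qed

lemma integrable_mult_tensor:
  assumes "integrable lebesgue w" "bumps a b \<psi>"
  shows "integrable lebesgue (\<lambda>x. w x * tensor \<psi> x)"
proof -
  obtain C where "\<And>x. \<bar>tensor \<psi> x\<bar> \<le> C"
    using continuous_bounded_cbox[OF continuous_on_subset[OF tensor_continuous[OF assms(2)] subset_UNIV]
      tensor_eq_0[OF assms(2)]] by metis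
  thus ?thesis by (rule integrable_mult_bounded_continuous[OF assms(1) tensor_continuous[OF assms(2)]])
qed

lemma integrable_lebesgue_cbox:
  fixes h :: "real^'n \<Rightarrow> real"
  assumes "continuous_on (cbox a b) h"
  shows "integrable lebesgue (\<lambda>x. indicator (cbox a b) x * h x)"
proof -
  have "set_integrable lborel (cbox a b) h"
    unfolding set_integrable_def by (rule borel_integrable_compact[OF compact_cbox assms])
  thus ?thesis unfolding set_integrable_def
    by (subst integrable_completion) auto
qed

text \<open>Boxes form an intersection-stable generator of the Borel sets, so the integrals of a
  Borel version \<open>v\<close> of \<open>w\<close> vanish over all Borel sets, in particular over
  the sets where \<open>v\<close> is positive or negative.\<close>

lemma AE_eq_0_if_box_integrals_0:
  fixes w :: "real^'n \<Rightarrow> real"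
  assumes w: "integrable lebesgue w"
    and zero: "\<And>c d. (LINT x|lebesgue. indicator (box c d) x * w x) = 0"
  shows "AE x in lebesgue. w x = 0"
proof -
  obtain v where v: "v \<in> borel_measurable lborel" "AE x in lborel. w x = v x"
    using completion_ex_borel_measurable_real[OF borel_measurable_integrable[OF w]] by auto
  have AEv: "AE x in lebesgue. w x = v x" using v(2) by (rule AE_completion)
  have vm: "v \<in> borel_measurable lebesgue" using v(1) by (rule measurable_completion)
  have "integrable lebesgue v"
    using w integrable_cong_AE[OF borel_measurable_integrable[OF w] vm AEv] by simp
  hence vi: "integrable lborel v" using v(1) by (simp add: integrable_completion)
  have box0: "(LINT x:box c d|lborel. v x) = 0" for c d :: "real^'n"
  proof -
    have "(LINT x:box c d|lborel. v x) = (LINT x|lebesgue. indicator (box c d) x * v x)"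
      unfolding set_lebesgue_integral_def using v(1) by (subst integral_completion) auto
    also have "\<dots> = (LINT x|lebesgue. indicator (box c d) x * w x)"
      using AEv by (intro integral_cong_AE borel_measurable_times borel_measurable_indicator vm
          borel_measurable_integrable[OF w]) auto
    finally show ?thesis using zero by simp
  qed
  have int: "set_integrable lborel A v" if "A \<in> sets borel" for A
    unfolding set_integrable_def using that vi integrable_mult_indicator[of A lborel v] by simp
  \<comment> \<open>The whole space is an increasing union of boxes; this value is what the
    complement case of the induction below requires.\<close>
  have UN: "(LINT x:UNIV|lborel. v x) = 0"
  proof -
    let ?B = "\<lambda>n. box (- (real n *\<^sub>R One)) (real n *\<^sub>R One) :: (real^'n) set"
    have "(\<lambda>n. LINT x:?B n|lborel. v x) \<longlonglongrightarrow> (LINT x:(\<Union>n. ?B n)|lborel. v x)"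
    proof (rule set_integral_cont_up)
      show "incseq ?B" by (auto simp: incseq_def box_def)
      show "set_integrable lborel (\<Union> (range ?B)) v" by (rule int) auto
    qed auto
    thus ?thesis unfolding box0 UN_box_eq_UNIV by (simp add: LIMSEQ_const_iff)
  qed
  have all: "(LINT x:A|lborel. v x) = 0" if "A \<in> sets borel" for A
  proof -
    have A: "A \<in> sigma_sets UNIV (range (\<lambda>(a, b). box a b))"
      using that by (simp add: borel_eq_box)
    show ?thesis
    proof (rule sigma_sets_induct_disjoint[OF _ _ A])
      show "Int_stable (range (\<lambda>(a, b). box a b :: (real^'n) set))"
        by (auto simp: Int_stable_def box_Int_box)
      show "range (\<lambda>(a, b). box a b :: (real^'n) set) \<subseteq> Pow UNIV" by simp
      show "(LINT x:A|lborel. v x) = 0" if "A \<in> range (\<lambda>(a, b). box a b)" for A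
        using that box0 by auto
      show "(LINT x:{}|lborel. v x) = 0" by (simp add: set_lebesgue_integral_def)
    next
      fix A :: "(real^'n) set"
      assume "A \<in> sigma_sets UNIV (range (\<lambda>(a, b). box a b))" and 0: "(LINT x:A|lborel. v x) = 0"
      hence A: "A \<in> sets borel" by (simp add: borel_eq_box)
      have "(LINT x:A \<union> (UNIV - A)|lborel. v x) = (LINT x:A|lborel. v x) + (LINT x:UNIV - A|lborel. v x)"
        using A by (intro set_integral_Un int) auto
      thus "(LINT x:UNIV - A|lborel. v x) = 0" using 0 UN by simp
    next
      fix A :: "nat \<Rightarrow> (real^'n) set"
      assume dis: "disjoint_family A" and "range A \<subseteq> sigma_sets UNIV (range (\<lambda>(a, b). box a b))"
        and 0: "\<And>i. (LINT x:A i|lborel. v x) = 0"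
      hence A: "A i \<in> sets borel" for i by (auto simp: borel_eq_box)
      have "(LINT x:(\<Union>i. A i)|lborel. v x) = (\<Sum>i. (LINT x:A i|lborel. v x))"
        using dis A by (intro lebesgue_integral_countable_add int) (auto simp: disjoint_family_on_def)
      thus "(LINT x:(\<Union>i. A i)|lborel. v x) = 0" using 0 by simp
    qed
  qed
  \<comment> \<open>Stated for a general \<open>g\<close> in order to be used for both
    \<open>v\<close> and \<open>-v\<close>.\<close>
  have half: "AE x in lborel. g x \<le> 0" if g: "g \<in> borel_measurable borel" "integrable lborel g"
    "\<And>A. A \<in> sets borel \<Longrightarrow> (LINT x:A|lborel. g x) = 0" for g :: "real^'n \<Rightarrow> real"
  proof -
    let ?A = "{x. g x > 0}"
    have A: "?A \<in> sets borel" using g(1) by measurable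
    have i: "integrable lborel (\<lambda>x. indicator ?A x * g x)"
      using integrable_mult_indicator[of ?A lborel g] A g(2) by simp
    have "AE x in lborel. indicator ?A x * g x = 0"
      using integral_nonneg_eq_0_iff_AE[OF i] g(3)[OF A]
      by (auto simp: set_lebesgue_integral_def indicator_def)
    thus ?thesis by eventually_elim (auto simp: indicator_def split: if_splits)
  qed
  have "AE x in lborel. v x \<le> 0" using v(1) vi all by (intro half) auto
  moreover have "AE x in lborel. - v x \<le> 0"
    using v(1) vi all by (intro half) (auto simp: set_lebesgue_integral_def)
  ultimately have "AE x in lborel. v x = 0" by eventually_elim auto
  hence "AE x in lebesgue. v x = 0" by (rule AE_completion)
  with AEv show ?thesis by eventually_elim simp
qed

text \<open>Tensor products of plateaus are bounded by 1 and converge to indicators of boxes, so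
  dominated convergence with dominating function |w| reduces this to integrals over boxes.\<close>

lemma AE_eq_0_if_tensor_integrals_0:
  fixes w :: "real^'n \<Rightarrow> real"
  assumes w: "integrable lebesgue w"
    and zero: "\<And>\<psi>. bumps a b \<psi> \<Longrightarrow> (LINT x|lebesgue. w x * tensor \<psi> x) = 0"
  shows "AE x in lebesgue. x \<in> box a b \<longrightarrow> w x = 0"
proof -
  let ?v = "\<lambda>x. indicator (box a b) x * w x"
  have box: "box a b \<in> sets lebesgue" by simp
  have v: "integrable lebesgue ?v" using integrable_mult_indicator[OF box w] by simp
  have "(LINT x|lebesgue. indicator (box c d) x * ?v x) = 0" for c d :: "real^'n"
  proof -
    \<comment> \<open>The sides of the intersection of the two boxes; taking this intersection keeps
      the supports inside the given box.\<close>
    define \<psi> where "\<psi> m i = plateau (max (a $ i) (c $ i)) (min (b $ i) (d $ i)) m" for m i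
    have \<psi>: "bumps a b (\<psi> m)" for m
      unfolding bumps_def \<psi>_def by (intro allI bump_plateau) auto
    have lim: "(\<lambda>m. tensor (\<psi> m) x) \<longlonglongrightarrow> indicator (box a b \<inter> box c d) x" for x
    proof -
      have "(\<lambda>m. tensor (\<psi> m) x) \<longlonglongrightarrow>
          (\<Prod>i\<in>UNIV. indicator {max (a $ i) (c $ i)<..<min (b $ i) (d $ i)} (x $ i))"
        unfolding tensor_def \<psi>_def by (intro tendsto_prod plateau_tendsto)
      also have "(\<Prod>i\<in>UNIV. indicator {max (a $ i) (c $ i)<..<min (b $ i) (d $ i)} (x $ i)) =
          (indicator (box a b \<inter> box c d) x :: real)"
      proof (cases "x \<in> box a b \<inter> box c d")
        case False
        then obtain i where i: "x $ i \<notin> {max (a $ i) (c $ i)<..<min (b $ i) (d $ i)}"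
          by (auto simp: mem_box_cart)
        have "(\<Prod>i\<in>UNIV. indicator {max (a $ i) (c $ i)<..<min (b $ i) (d $ i)} (x $ i)) = (0::real)"
          by (intro prod_zero bexI[of _ i]) (use i in \<open>auto simp: indicator_def\<close>)
        thus ?thesis using False by simp
      qed (auto simp: mem_box_cart)
      finally show ?thesis .
    qed
    have bd: "norm (tensor (\<psi> m) x) \<le> 1" for m x
    proof -
      have "0 \<le> tensor (\<psi> m) x" by (simp add: tensor_def \<psi>_def prod_nonneg plateau_bounds)
      moreover have "tensor (\<psi> m) x \<le> 1"
        unfolding tensor_def \<psi>_def by (intro prod_le_1) (simp add: plateau_bounds)
      ultimately show ?thesis by simp
    qed
    have mT: "tensor (\<psi> m) \<in> borel_measurable lebesgue" for m
      using tensor_continuous[OF \<psi>] by (intro measurable_completion) (simp add: borel_measurable_continuous_onI)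
    have "(\<lambda>m. LINT x|lebesgue. w x * tensor (\<psi> m) x) \<longlonglongrightarrow>
        (LINT x|lebesgue. w x * indicator (box a b \<inter> box c d) x)"
    proof (rule integral_dominated_convergence[where w="\<lambda>x. \<bar>w x\<bar>"])
      show "AE x in lebesgue. (\<lambda>m. w x * tensor (\<psi> m) x) \<longlonglongrightarrow> w x * indicator (box a b \<inter> box c d) x"
        by (intro AE_I2 tendsto_mult tendsto_const lim)
      show "AE x in lebesgue. norm (w x * tensor (\<psi> m) x) \<le> \<bar>w x\<bar>" for m
        using bd[of m] by (intro AE_I2) (simp add: abs_mult mult_left_le)
      show "(\<lambda>x. w x * indicator (box a b \<inter> box c d) x) \<in> borel_measurable lebesgue"
        by (intro borel_measurable_times borel_measurable_integrable[OF w] borel_measurable_indicator sets.Int) auto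
      show "(\<lambda>x. w x * tensor (\<psi> m) x) \<in> borel_measurable lebesgue" for m
        by (intro borel_measurable_times borel_measurable_integrable[OF w] mT)
    qed (use w in auto)
    hence "(LINT x|lebesgue. w x * indicator (box a b \<inter> box c d) x) = 0"
      using zero[OF \<psi>] by (simp add: LIMSEQ_const_iff)
    thus ?thesis by (simp add: indicator_inter_arith mult_ac)
  qed
  from AE_eq_0_if_box_integrals_0[OF v this] show ?thesis by eventually_elim auto
qed

section \<open>Translation invariance and integration by parts\<close>

lemma integral_shift:
  fixes \<phi> :: "real^'n \<Rightarrow> real"
  assumes "\<phi> \<in> borel_measurable borel"
  shows "(LINT x|lborel. \<phi> (x + c)) = (LINT x|lborel. \<phi> x)"
    and "integrable lborel \<phi> \<Longrightarrow> integrable lborel (\<lambda>x. \<phi> (x + c))"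
proof -
  have "(LINT x|distr lborel borel ((+) c). \<phi> x) = (LINT x|lborel. \<phi> (c + x))"
    using assms by (intro integral_distr) auto
  thus "(LINT x|lborel. \<phi> (x + c)) = (LINT x|lborel. \<phi> x)" by (simp add: lborel_distr_plus add.commute)
  assume "integrable lborel \<phi>"
  hence "integrable (distr lborel borel ((+) c)) \<phi>" by (simp add: lborel_distr_plus)
  thus "integrable lborel (\<lambda>x. \<phi> (x + c))"
    using assms by (subst (asm) integrable_distr_eq) (auto simp: add.commute)
qed

text \<open>By translation invariance all difference quotients of \<open>\<phi>\<close> have integral zero.\<close>

lemma integral_directional_derivative_eq_0:
  fixes \<phi> \<phi>' :: "real^'n \<Rightarrow> real"
  assumes der: "\<And>x. ((\<lambda>t. \<phi> (x + t *\<^sub>R v)) has_real_derivative \<phi>' x) (at 0)"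
    and cont: "continuous_on UNIV \<phi>" and zero: "\<And>x. x \<notin> cbox a b \<Longrightarrow> \<phi> x = 0"
    and m': "\<phi>' \<in> borel_measurable borel" and bd: "\<And>x. \<bar>\<phi>' x\<bar> \<le> C"
  shows "(LINT x|lborel. \<phi>' x) = 0"
proof -
  have m: "\<phi> \<in> borel_measurable borel" using cont by (rule borel_measurable_continuous_onI)
  have int: "integrable lborel \<phi>"
  proof -
    have "integrable lborel (\<lambda>x. indicator (cbox a b) x *\<^sub>R \<phi> x)"
      using borel_integrable_compact[OF compact_cbox continuous_on_subset[OF cont subset_UNIV]]
      by (simp add: set_integrable_def)
    moreover have "(\<lambda>x. indicator (cbox a b) x *\<^sub>R \<phi> x) = \<phi>"
      by (rule ext) (use zero in \<open>auto simp: indicator_def\<close>)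
    ultimately show ?thesis by simp
  qed
  obtain R where R: "\<And>x. x \<in> cbox a b \<Longrightarrow> norm x \<le> R"
    using bounded_cbox[of a b] unfolding bounded_iff by auto
  define h where "h n = inverse (real (Suc n))" for n
  have h: "0 < h n" "h n \<le> 1" for n by (auto simp: h_def inverse_le_1_iff)
  define q where "q n x = (\<phi> (x + h n *\<^sub>R v) - \<phi> x) / h n" for n x
  have line: "((\<lambda>t. \<phi> (x + t *\<^sub>R v)) has_real_derivative \<phi>' (x + t *\<^sub>R v)) (at t)" for x t
    using der[of "x + t *\<^sub>R v"] DERIV_shift[of "\<lambda>s. \<phi> (x + s *\<^sub>R v)" _ 0 t]
    by (simp add: scaleR_add_left add_ac)
  \<comment> \<open>A common dominating function: the mean value theorem bounds the quotients by
    \<open>C\<close>, and since the steps are at most 1, both values of \<open>\<phi>\<close> are 0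
    outside the larger ball.\<close>
  have qb: "norm (q n x) \<le> C * indicator (cball 0 (R + norm v)) x" for n x
  proof (cases "x \<in> cball 0 (R + norm v)")
    case True
    obtain z where "\<phi> (x + h n *\<^sub>R v) - \<phi> (x + 0 *\<^sub>R v) = (h n - 0) * \<phi>' (x + z *\<^sub>R v)"
      using MVT2[OF h(1)[of n], of "\<lambda>t. \<phi> (x + t *\<^sub>R v)" "\<lambda>t. \<phi>' (x + t *\<^sub>R v)"] line by blast
    hence "q n x = \<phi>' (x + z *\<^sub>R v)" using h(1)[of n] by (simp add: q_def)
    thus ?thesis using bd True by simp
  next
    case False
    have "norm x - norm (h n *\<^sub>R v) \<le> norm (x + h n *\<^sub>R v)"
      using norm_triangle_ineq2[of x "- (h n *\<^sub>R v)"] by simp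
    moreover have "norm (h n *\<^sub>R v) \<le> norm v" using h[of n] by (simp add: mult_left_le_one_le)
    ultimately have "norm (x + h n *\<^sub>R v) > R" using False by simp
    hence "x + h n *\<^sub>R v \<notin> cbox a b" using R by force
    moreover have "x \<notin> cbox a b"
    proof
      assume "x \<in> cbox a b"
      hence "norm x \<le> R" by (rule R)
      hence "norm x \<le> R + norm v" using norm_ge_zero[of v] by linarith
      thus False using False by simp
    qed
    ultimately show ?thesis using zero False by (simp add: q_def)
  qed
  have "(\<lambda>n. LINT x|lborel. q n x) \<longlonglongrightarrow> (LINT x|lborel. \<phi>' x)"
  proof (rule integral_dominated_convergence)
    show "integrable lborel (\<lambda>x. C * indicator (cball (0::real^'n) (R + norm v)) x)"
      using emeasure_bounded_finite[OF bounded_cball[of "0::real^'n" "R + norm v"]]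
      by (intro integrable_mult_right integrable_real_indicator) (auto simp: infinity_ennreal_def)
    show "AE x in lborel. norm (q n x) \<le> C * indicator (cball 0 (R + norm v)) x" for n
      using qb by (intro AE_I2)
    show "AE x in lborel. (\<lambda>n. q n x) \<longlonglongrightarrow> \<phi>' x"
    proof (intro AE_I2)
      fix x
      have "filterlim h (at 0) sequentially"
        using LIMSEQ_inverse_real_of_nat h(1) unfolding h_def[abs_def]
        by (auto simp: filterlim_at eventually_sequentially)
      from filterlim_compose[OF der[of x, unfolded DERIV_def] this]
      show "(\<lambda>n. q n x) \<longlonglongrightarrow> \<phi>' x" by (simp add: q_def)
    qed
    show "q n \<in> borel_measurable lborel" for n
      unfolding q_def using m by measurable
  qed (use m' in auto)
  moreover have "(LINT x|lborel. q n x) = 0" for n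
    unfolding q_def using integral_shift[OF m, of "h n *\<^sub>R v"] int by simp
  ultimately show ?thesis by (simp add: LIMSEQ_const_iff)
qed

text \<open>The product of \<open>h\<close> with the tensor function, extended by 0, has integrable
  \<open>j\<close>-th partial derivative with integral zero; the product rule splits that integral
  into the two sides.\<close>

lemma integration_by_parts_tensor:
  fixes h :: "real^'n \<Rightarrow> real"
  assumes h: "smooth_on U h" and U: "open U" "cbox a b \<subseteq> U" and \<psi>: "bumps a b \<psi>"
  shows "(LINT x|lebesgue. (indicator (cbox a b) x * h x) * tensor (\<psi>(j := deriv (\<psi> j))) x) =
    - (LINT x|lebesgue. (indicator (cbox a b) x * frechet_derivative h (at x) (axis j 1)) * tensor \<psi> x)"
proof -
  let ?T = "tensor \<psi>" and ?T' = "tensor (\<psi>(j := deriv (\<psi> j)))"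
  let ?h' = "\<lambda>x. frechet_derivative h (at x) (axis j 1)"
  have \<psi>': "bumps a b (\<psi>(j := deriv (\<psi> j)))"
    by (intro bumps_upd \<psi> bump_deriv bumpsD)
  define \<phi> where "\<phi> x = (if x \<in> cbox a b then h x * ?T x else 0)" for x
  define \<phi>' where "\<phi>' x = indicator (cbox a b) x * (h x * ?T' x + ?h' x * ?T x)" for x
  have \<phi>U: "\<phi> x = h x * ?T x" for x using tensor_eq_0[OF \<psi>, of x] by (auto simp: \<phi>_def)
  have \<phi>'U: "\<phi>' x = h x * ?T' x + ?h' x * ?T x" for x
    using tensor_eq_0[OF \<psi>, of x] tensor_eq_0[OF \<psi>', of x] by (auto simp: \<phi>'_def indicator_def)
  have sm: "smooth_on UNIV ?T" by (rule smooth_on_tensor[OF \<psi>])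
  \<comment> \<open>Two open sets cover the space: on \<open>U\<close> the product rule applies, and
    on the complement of the closed box \<open>\<phi>\<close> is identically 0.\<close>
  have der: "\<exists>D. (\<phi> has_derivative D) (at x) \<and> D (axis j 1) = \<phi>' x" for x
  proof (cases "x \<in> U")
    case True
    have "((\<lambda>x. h x * ?T x) has_derivative
      (\<lambda>v. h x * frechet_derivative ?T (at x) v + frechet_derivative h (at x) v * ?T x)) (at x)"
      using smooth_on_has_derivative[OF h U(1) True] smooth_on_has_derivative[OF sm open_UNIV UNIV_I]
      by (intro has_derivative_mult)
    moreover have "(\<lambda>x. h x * ?T x) = \<phi>" using \<phi>U by auto
    ultimately show ?thesis using \<phi>'U[of x] tensor_has_partial[OF \<psi>, of x j] by auto
  next
    case False
    hence "x \<in> - cbox a b" using U(2) by auto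
    hence "(\<phi> has_derivative (\<lambda>_. 0)) (at x)"
      by (intro has_derivative_transform_within_open[OF has_derivative_const, of "- cbox a b"])
        (auto simp: \<phi>_def)
    thus ?thesis using \<open>x \<in> - cbox a b\<close> by (auto simp: \<phi>'_def)
  qed
  have cont: "continuous_on UNIV \<phi>"
    using der by (auto simp: continuous_on_eq_continuous_at intro: has_derivative_continuous)
  have cont_h: "continuous_on (cbox a b) h" "continuous_on (cbox a b) ?h'"
    using U(2) smooth_on_imp_continuous_on[OF h] smooth_on_imp_continuous_on[OF smooth_on_frechet_derivative[OF h]]
    by (auto intro: continuous_on_subset)
  have cont': "continuous_on (cbox a b) (\<lambda>x. h x * ?T' x + ?h' x * ?T x)"
    by (intro continuous_intros cont_h continuous_on_subset[OF tensor_continuous[OF \<psi>]]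
        continuous_on_subset[OF tensor_continuous[OF \<psi>']]) auto
  have "continuous_on (cbox a b) \<phi>'" using cont' by (simp add: \<phi>'_def cong: continuous_on_cong)
  moreover have "\<phi>' x = 0" if "x \<notin> cbox a b" for x using that by (simp add: \<phi>'_def)
  ultimately obtain C where C: "\<And>x. \<bar>\<phi>' x\<bar> \<le> C" using continuous_bounded_cbox by metis
  have m': "\<phi>' \<in> borel_measurable borel"
    using borel_measurable_continuous_on_indicator[OF _ cont'] by (simp add: \<phi>'_def[abs_def])
  have line: "((\<lambda>t. \<phi> (x + t *\<^sub>R axis j 1)) has_real_derivative \<phi>' x) (at 0)" for x
  proof -
    obtain D where D: "(\<phi> has_derivative D) (at x)" "D (axis j 1) = \<phi>' x" using der by blast
    have 1: "((\<lambda>t. x + t *\<^sub>R axis j 1) has_derivative (\<lambda>t. t *\<^sub>R axis j (1::real))) (at (0::real))"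
      by (auto intro!: derivative_eq_intros)
    have 2: "(\<phi> has_derivative D) (at (x + 0 *\<^sub>R axis j 1))" using D(1) by simp
    have "(\<lambda>t. D (t *\<^sub>R axis j 1)) = (*) (\<phi>' x)"
      using has_derivative_linear[OF D(1)] D(2) by (auto simp: linear_cmul)
    thus ?thesis using diff_chain_at[OF 1 2] by (simp add: has_field_derivative_def o_def)
  qed
  have "(LINT x|lborel. \<phi>' x) = 0"
    by (rule integral_directional_derivative_eq_0[OF line cont _ m' C, where a=a and b=b]) (simp add: \<phi>_def)
  hence "(LINT x|lebesgue. \<phi>' x) = 0" using m' by (subst integral_completion) auto
  moreover have "(LINT x|lebesgue. \<phi>' x) =
      (LINT x|lebesgue. (indicator (cbox a b) x * h x) * ?T' x) +
      (LINT x|lebesgue. (indicator (cbox a b) x * ?h' x) * ?T x)"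
    using Bochner_Integration.integral_add[OF
        integrable_mult_tensor[OF integrable_lebesgue_cbox[OF cont_h(1)] \<psi>']
        integrable_mult_tensor[OF integrable_lebesgue_cbox[OF cont_h(2)] \<psi>]]
    unfolding \<phi>'_def by (simp add: algebra_simps)
  ultimately show ?thesis by simp
qed

text \<open>Every \<open>\<psi>\<^sub>j\<close> differs from \<open>(\<integral>\<psi>\<^sub>j) \<eta>\<^sub>j\<close> by the derivative of a bump, so the factors of a tensor
  product can be exchanged one coordinate at a time.\<close>

lemma weakly_constant_functional:
  fixes u :: "real^'n \<Rightarrow> real"
  assumes ab: "\<And>i. a $ i < b $ i" and u: "integrable lebesgue u"
    and weak: "\<And>j \<psi>. bumps a b \<psi> \<Longrightarrow> (LINT x|lebesgue. u x * tensor (\<psi>(j := deriv (\<psi> j))) x) = 0"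
    and \<eta>: "bumps a b \<eta>" "\<And>i. integral {a $ i..b $ i} (\<eta> i) = 1" and \<psi>: "bumps a b \<psi>"
  shows "(LINT x|lebesgue. u x * tensor \<psi> x) =
    (\<Prod>i\<in>UNIV. integral {a $ i..b $ i} (\<psi> i)) * (LINT x|lebesgue. u x * tensor \<eta> x)"
proof -
  let ?c = "\<lambda>i. integral {a $ i..b $ i} (\<psi> i)"
  let ?\<psi> = "\<lambda>J i. if i \<in> J then \<eta> i else \<psi> i"
  have b: "bumps a b (?\<psi> J)" for J using \<eta>(1) \<psi> by (simp add: bumps_def)
  have "(LINT x|lebesgue. u x * tensor \<psi> x) = (\<Prod>i\<in>J. ?c i) * (LINT x|lebesgue. u x * tensor (?\<psi> J) x)"
    if "finite J" for J
    using that
  proof (induction J rule: finite_induct)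
    case (insert j J)
    define d where "d t = \<psi> j t + (- ?c j) * \<eta> j t" for t
    have bd: "bump (a $ j) (b $ j) d"
      unfolding d_def by (intro bump_combine bumpsD \<psi> \<eta>)
    have "integral {a $ j..b $ j} d = ?c j + integral {a $ j..b $ j} (\<lambda>t. (- ?c j) * \<eta> j t)"
      unfolding d_def
      by (intro Henstock_Kurzweil_Integration.integral_add integrable_on_mult_right
          bump_integrable[OF bumpsD[OF \<psi>]] bump_integrable[OF bumpsD[OF \<eta>(1)]])
    also have "\<dots> = ?c j + (- ?c j) * integral {a $ j..b $ j} (\<eta> j)"
      by (simp only: Henstock_Kurzweil_Integration.integral_mult_right)
    finally have "integral {a $ j..b $ j} d = ?c j + (- ?c j) * integral {a $ j..b $ j} (\<eta> j)" .
    hence "integral {a $ j..b $ j} d = 0" using \<eta>(2) by simp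
    then obtain \<Psi> where \<Psi>: "bump (a $ j) (b $ j) \<Psi>" "deriv \<Psi> = d"
      using bump_antiderivative[OF bd _ ab] by metis
    have "(LINT x|lebesgue. u x * tensor ((?\<psi> J)(j := d)) x) = 0"
      using weak[OF bumps_upd[OF b[of J] \<Psi>(1)], of j] \<Psi>(2) by simp
    moreover have e: "(?\<psi> J)(j := \<psi> j) = ?\<psi> J" "(?\<psi> J)(j := \<eta> j) = ?\<psi> (insert j J)"
      using insert.hyps by (auto simp: fun_eq_iff)
    have eqn: "u x * tensor (?\<psi> J) x = u x * tensor ((?\<psi> J)(j := d)) x + ?c j * (u x * tensor (?\<psi> (insert j J)) x)" for x
      \<comment> \<open>Viewing \<open>?\<psi> J\<close> as its own update at \<open>j\<close> lets
        \<open>tensor_upd\<close> split off the \<open>j\<close>-th factor in all three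
        terms.\<close>
      unfolding e(2)[symmetric] tensor_upd
      unfolding trans[OF arg_cong[where f="\<lambda>f. tensor f x", OF e(1)[symmetric]] tensor_upd]
      by (simp add: d_def algebra_simps)
    have "(LINT x|lebesgue. u x * tensor (?\<psi> J) x) = (LINT x|lebesgue. u x * tensor ((?\<psi> J)(j := d)) x) +
        ?c j * (LINT x|lebesgue. u x * tensor (?\<psi> (insert j J)) x)"
      unfolding eqn using Bochner_Integration.integral_add[OF integrable_mult_tensor[OF u bumps_upd[OF b[of J] bd]]
          integrable_mult_right[OF integrable_mult_tensor[OF u b[of "insert j J"]], of "?c j"]]
      by simp
    ultimately show ?case using insert by simp
  qed simp
  from this[of UNIV] show ?thesis by simp
qed

text \<open>Integration against \<open>u\<close> and against the constant 1 both act on tensor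
  products as multiples of the same product of integrals. Subtracting the right multiple of 1 leaves
  a function orthogonal to all of them.\<close>

lemma AE_constant_if_weak_gradient_0:
  fixes u :: "real^'n \<Rightarrow> real"
  assumes ab: "\<And>i. a $ i < b $ i" and u: "integrable lebesgue u"
    and weak: "\<And>j \<psi>. bumps a b \<psi> \<Longrightarrow> (LINT x|lebesgue. u x * tensor (\<psi>(j := deriv (\<psi> j))) x) = 0"
  obtains c where "AE x in lebesgue. x \<in> box a b \<longrightarrow> u x = c"
proof -
  have "\<exists>\<eta>. bump (a $ i) (b $ i) \<eta> \<and> integral {a $ i..b $ i} \<eta> = 1 \<and> (\<forall>t. \<eta> t \<ge> 0) \<and>
      (\<forall>t. a $ i < t \<longrightarrow> t < b $ i \<longrightarrow> \<eta> t > 0)" for i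
    using bump_normalized[OF ab] by metis
  then obtain \<eta> where \<eta>: "\<And>i. bump (a $ i) (b $ i) (\<eta> i)" "\<And>i. integral {a $ i..b $ i} (\<eta> i) = 1"
    "\<And>i t. \<eta> i t \<ge> 0" "\<And>i t. a $ i < t \<Longrightarrow> t < b $ i \<Longrightarrow> \<eta> i t > 0"
    by metis
  have b\<eta>: "bumps a b \<eta>" using \<eta>(1) by (simp add: bumps_def)
  \<comment> \<open>The constant 1, cut off to be integrable; the tensor products vanish outside the
    box anyway.\<close>
  let ?one = "\<lambda>x::real^'n. indicator (cbox a b) x * (1::real)"
  have one: "integrable lebesgue ?one" by (intro integrable_lebesgue_cbox continuous_intros)
  have weak1: "(LINT x|lebesgue. ?one x * tensor (\<psi>(j := deriv (\<psi> j))) x) = 0" if "bumps a b \<psi>" for j \<psi>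
    using integration_by_parts_tensor[OF smooth_on_const open_UNIV subset_UNIV that, of 1 j]
    by (simp add: frechet_derivative_const)
  define m where "m = (LINT x|lebesgue. ?one x * tensor \<eta> x)"
  \<comment> \<open>The integrand is nonnegative and strictly positive on the nonempty open
    box.\<close>
  have "m \<noteq> 0"
  proof
    assume m0: "m = 0"
    have ge: "?one x * tensor \<eta> x \<ge> 0" for x using \<eta>(3) by (auto simp: tensor_def intro!: mult_nonneg_nonneg prod_nonneg)
    have AE0: "AE x in lebesgue. ?one x * tensor \<eta> x = 0"
      using integral_nonneg_eq_0_iff_AE[OF integrable_mult_tensor[OF one b\<eta>]] ge m0 by (auto simp: m_def)
    have pos: "?one x * tensor \<eta> x > 0" if "x \<in> box a b" for x
    proof -
      have "x \<in> cbox a b" using that box_subset_cbox by blast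
      moreover have "tensor \<eta> x > 0"
        using that \<eta>(4) by (auto simp: tensor_def mem_box_cart intro!: prod_pos)
      ultimately show ?thesis by simp
    qed
    from AE0 have "AE x in lebesgue. x \<notin> box a b" by eventually_elim (use pos in force)
    hence "negligible (box a b)" by (simp add: AE_iff_null_sets negligible_iff_null_sets)
    moreover have "box a b \<noteq> {}" using ab by (simp add: interval_ne_empty_cart)
    ultimately show False using open_not_negligible[OF open_box] by blast
  qed
  define c where "c = (LINT x|lebesgue. u x * tensor \<eta> x) / m"
  have w: "integrable lebesgue (\<lambda>x. u x - c * ?one x)" using u one by auto
  have "AE x in lebesgue. x \<in> box a b \<longrightarrow> u x - c * ?one x = 0"
  proof (rule AE_eq_0_if_tensor_integrals_0[OF w])
    fix \<psi> assume \<psi>: "bumps a b \<psi>"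
    have "(LINT x|lebesgue. (u x - c * ?one x) * tensor \<psi> x) =
        (LINT x|lebesgue. u x * tensor \<psi> x) - c * (LINT x|lebesgue. ?one x * tensor \<psi> x)"
      using integrable_mult_tensor[OF u \<psi>] integrable_mult_tensor[OF one \<psi>]
      by (simp add: left_diff_distrib mult.assoc)
    also have "\<dots> = 0"
      using weakly_constant_functional[OF ab u weak b\<eta> \<eta>(2) \<psi>]
        weakly_constant_functional[OF ab one weak1 b\<eta> \<eta>(2) \<psi>] \<open>m \<noteq> 0\<close>
      by (simp add: c_def m_def)
    finally show "(LINT x|lebesgue. (u x - c * ?one x) * tensor \<psi> x) = 0" .
  qed
  hence "AE x in lebesgue. x \<in> box a b \<longrightarrow> u x = c"
    by eventually_elim (use box_subset_cbox[of a b] in auto)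
  thus ?thesis by (rule that)
qed

section \<open>From a.e. identities to points, and the Poincare lemma on convex sets\<close>

lemma ex_point_of_AE:
  fixes U :: "(real^'n) set"
  assumes "AE x in lebesgue. P x" "open U" "U \<noteq> {}"
  obtains x where "x \<in> U" "P x"
proof -
  have "\<exists>x\<in>U. P x"
  proof (rule ccontr)
    assume "\<not> (\<exists>x\<in>U. P x)"
    hence "AE x in lebesgue. x \<notin> U" using assms(1) by (auto elim: eventually_mono)
    moreover have "U \<in> sets lebesgue" using borel_open[OF assms(2)] by simp
    ultimately have "negligible U" by (simp add: AE_iff_null_sets negligible_iff_null_sets)
    thus False using open_not_negligible assms(2,3) by blast
  qed
  thus ?thesis using that by blast
qed

lemma continuous_AE_eq_0:
  fixes g :: "real^'n \<Rightarrow> 'b::real_normed_vector"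
  assumes "open S" "continuous_on S g" "AE x in lebesgue. x \<in> S \<longrightarrow> g x = 0" "x \<in> S"
  shows "g x = 0"
proof (rule ccontr)
  assume "g x \<noteq> 0"
  let ?N = "S \<inter> g -` (- {0})"
  have "open ?N" using assms(1,2) by (intro continuous_open_preimage) auto
  moreover have "?N \<noteq> {}" using \<open>g x \<noteq> 0\<close> assms(4) by auto
  ultimately obtain y where "y \<in> ?N" "y \<in> S \<longrightarrow> g y = 0" using ex_point_of_AE[OF assms(3)] by metis
  thus False by simp
qed

lemma linear_eq_sum_axis:
  fixes L :: "real^'n \<Rightarrow> real"
  assumes "linear L"
  shows "L v = (\<Sum>l\<in>UNIV. L (axis l 1) * v $ l)"
proof -
  have "L v = L (\<Sum>l\<in>UNIV. v $ l *\<^sub>R axis l 1)"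
    using basis_expansion[of v] by (simp add: scalar_mult_eq_scaleR)
  also have "\<dots> = (\<Sum>l\<in>UNIV. L (axis l 1) * v $ l)"
    using assms by (simp add: linear_sum linear_cmul mult.commute)
  finally show ?thesis .
qed

text \<open>The primitive is the line integral of \<open>G\<close> along the segment from
  \<open>x0\<close> to \<open>x\<close>. Differentiating under the integral and using symmetry of
  the derivatives turns the \<open>l\<close>-th partial of the integrand into the
  \<open>t\<close>-derivative of t G_l, which integrates to G_l(x).\<close>

lemma curl_free_imp_gradient:
  fixes G :: "'n \<Rightarrow> real^'n \<Rightarrow> real"
  assumes S: "open S" "convex S" "x0 \<in> S" and sm: "\<And>j. smooth_on S (G j)"
    and curl: "\<And>x j l. x \<in> S \<Longrightarrow>
      frechet_derivative (G j) (at x) (axis l 1) = frechet_derivative (G l) (at x) (axis j 1)"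
  obtains h where "\<And>x. x \<in> S \<Longrightarrow> (h has_derivative (\<lambda>v. \<Sum>j\<in>UNIV. G j x * v $ j)) (at x)"
proof -
  define p where "p x t = x0 + t *\<^sub>R (x - x0)" for x t
  define D where "D j l y = frechet_derivative (G j) (at y) (axis l 1)" for j l y
  \<comment> \<open>This expression plays both roles: the \<open>l\<close>-th partial derivative of
    the integrand \<open>f\<close> and the derivative in \<open>t\<close> of
    \<open>t * G l (p x t)\<close>.\<close>
  define A where "A l x t = G l (p x t) + t * (\<Sum>j\<in>UNIV. D l j (p x t) * (x - x0) $ j)" for l x t
  define f where "f x t = (\<Sum>j\<in>UNIV. G j (p x t) * (x - x0) $ j)" for x t
  \<comment> \<open>Coordinate functionals as bounded linear maps, the form in which
    \<open>leibniz_rule\<close> takes the derivative.\<close>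
  define E :: "'n \<Rightarrow> (real^'n) \<Rightarrow>\<^sub>L real" where "E l = Blinfun (\<lambda>v. v $ l)" for l
  define fx where "fx x t = (\<Sum>l\<in>UNIV. A l x t *\<^sub>R E l)" for x t
  have E: "blinfun_apply (E l) v = v $ l" for l v
    by (simp add: E_def bounded_linear_Blinfun_apply[OF bounded_linear_vec_nth])
  have fxv: "blinfun_apply (fx x t) v = (\<Sum>l\<in>UNIV. A l x t * v $ l)" for x t v
    by (simp add: fx_def blinfun.sum_left blinfun.scaleR_left E)
  have pS: "p x t \<in> S" if "x \<in> S" "t \<in> {0..1}" for x t
  proof -
    have "(1 - t) *\<^sub>R x0 + t *\<^sub>R x \<in> S" using S that by (intro convexD) auto
    thus ?thesis by (simp add: p_def algebra_simps)
  qed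
  have GD: "(G j has_derivative (\<lambda>v. \<Sum>l\<in>UNIV. D j l y * v $ l)) (at y)" if "y \<in> S" for j y
  proof -
    note d = smooth_on_has_derivative[OF sm S(1) that, of j]
    have "frechet_derivative (G j) (at y) = (\<lambda>v. \<Sum>l\<in>UNIV. D j l y * v $ l)"
      unfolding D_def by (rule ext) (rule linear_eq_sum_axis[OF has_derivative_linear[OF d]])
    thus ?thesis using d by simp
  qed
  have contp: "continuous_on (S \<times> {0..1}) (\<lambda>z. g (p (fst z) (snd z)))"
    if "continuous_on S g" for g :: "real^'n \<Rightarrow> real"
  proof (rule continuous_on_compose2[OF that])
    show "continuous_on (S \<times> {0..1}) (\<lambda>z. p (fst z) (snd z))"
      unfolding p_def by (intro continuous_intros)
  qed (use pS in auto)
  have contG: "continuous_on S (G j)" and contD: "continuous_on S (D j l)" for j l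
    unfolding D_def using sm[of j] by (auto intro: smooth_on_imp_continuous_on smooth_on_frechet_derivative)
  have contA: "continuous_on (S \<times> {0..1}) (\<lambda>z. A l (fst z) (snd z))" for l
    unfolding A_def by (intro continuous_intros contp contG contD)
  have contf: "continuous_on (S \<times> {0..1}) (\<lambda>z. f (fst z) (snd z))"
    unfolding f_def by (intro continuous_intros contp contG)
  have slice: "continuous_on {0..1} (\<lambda>t. g x t)"
    if "continuous_on (S \<times> {0..1}) (\<lambda>z. g (fst z) (snd z))" "x \<in> S" for g :: "real^'n \<Rightarrow> real \<Rightarrow> real" and x
  proof -
    have "continuous_on {0..1} (\<lambda>t. g (fst (x, t)) (snd (x, t)))"
      using that(2) by (intro continuous_on_compose2[OF that(1), of _ "\<lambda>t. (x, t)"] continuous_intros) auto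
    thus ?thesis by simp
  qed
  have der: "((\<lambda>x. f x t) has_derivative blinfun_apply (fx x t)) (at x within S)"
    if x: "x \<in> S" and t: "t \<in> cbox 0 1" for x t
  proof -
    have p: "((\<lambda>x. p x t) has_derivative (\<lambda>v. t *\<^sub>R v)) (at x)"
      unfolding p_def by (auto intro!: derivative_eq_intros)
    have y: "p x t \<in> S" using pS[OF x] t by simp
    have g: "((\<lambda>x. G j (p x t)) has_derivative (\<lambda>v. \<Sum>l\<in>UNIV. D j l (p x t) * (t *\<^sub>R v) $ l)) (at x)" for j
      using diff_chain_at[OF p GD[OF y, of j]] by (simp add: o_def)
    have c: "((\<lambda>x. (x - x0) $ j) has_derivative (\<lambda>v. v $ j)) (at x)" for j
      by (rule has_derivative_eq_rhs[OF bounded_linear.has_derivative[OF bounded_linear_vec_nth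
            has_derivative_diff[OF has_derivative_ident has_derivative_const]]]) simp
    have Dc: "D j l (p x t) = D l j (p x t)" for j l unfolding D_def by (rule curl[OF y])
    have "((\<lambda>x. f x t) has_derivative (\<lambda>v. \<Sum>j\<in>UNIV. G j (p x t) * v $ j +
        (\<Sum>l\<in>UNIV. D j l (p x t) * (t *\<^sub>R v) $ l) * (x - x0) $ j)) (at x)"
      unfolding f_def by (intro has_derivative_sum has_derivative_mult g c)
    moreover have "(\<Sum>j\<in>UNIV. G j (p x t) * v $ j + (\<Sum>l\<in>UNIV. D j l (p x t) * (t *\<^sub>R v) $ l) * (x - x0) $ j)
        = blinfun_apply (fx x t) v" for v
    proof -
      have "(\<Sum>j\<in>UNIV. (\<Sum>l\<in>UNIV. D j l (p x t) * (t *\<^sub>R v) $ l) * (x - x0) $ j) =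
          (\<Sum>l\<in>UNIV. \<Sum>j\<in>UNIV. D j l (p x t) * (t * v $ l) * (x - x0) $ j)"
        unfolding sum_distrib_right by (subst sum.swap) simp
      also have "\<dots> = (\<Sum>l\<in>UNIV. t * (\<Sum>j\<in>UNIV. D l j (p x t) * (x - x0) $ j) * v $ l)"
        unfolding sum_distrib_left sum_distrib_right
        by (intro sum.cong refl) (subst Dc, simp)
      finally show ?thesis
        unfolding fxv A_def sum.distrib distrib_right by simp
    qed
    ultimately show ?thesis by (simp add: has_derivative_at_withinI)
  qed
  define h where "h x = integral (cbox 0 1) (f x)" for x
  have "(h has_derivative (\<lambda>v. \<Sum>j\<in>UNIV. G j x * v $ j)) (at x)" if x: "x \<in> S" for x
  proof -
    have cfx: "continuous_on (S \<times> cbox 0 1) (\<lambda>(x, t). fx x t)"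
      unfolding fx_def split_def using contA by (auto intro!: continuous_intros)
    have "(h has_derivative integral (cbox 0 1) (fx x)) (at x within S)"
      unfolding h_def
      by (rule leibniz_rule[OF der _ cfx x S(2)])
        (auto intro!: integrable_continuous_interval slice[OF contf])
    hence "(h has_derivative integral (cbox 0 1) (fx x)) (at x)"
      by (simp only: at_within_open[OF x S(1)])
    moreover have "blinfun_apply (integral (cbox 0 1) (fx x)) = (\<lambda>v. \<Sum>j\<in>UNIV. G j x * v $ j)"
    proof -
      have "(A l x has_integral G l x) {0..1}" for l
      proof -
        have "((\<lambda>t. t * G l (p x t)) has_vector_derivative A l x t) (at t within {0..1})"
          if t: "t \<in> {0..1}" for t
        proof -
          have p: "((\<lambda>t. p x t) has_derivative (\<lambda>s. s *\<^sub>R (x - x0))) (at t)"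
            unfolding p_def by (auto intro!: derivative_eq_intros)
          have "((\<lambda>t. G l (p x t)) has_derivative (\<lambda>s. \<Sum>j\<in>UNIV. D l j (p x t) * (s *\<^sub>R (x - x0)) $ j)) (at t)"
            using diff_chain_at[OF p GD[OF pS[OF x t], of l]] by (simp add: o_def)
          from has_derivative_mult[OF has_derivative_ident this]
          have "((\<lambda>t. t * G l (p x t)) has_derivative (\<lambda>s. s * A l x t)) (at t)"
            by (rule has_derivative_eq_rhs) (auto simp: A_def sum_distrib_left algebra_simps)
          hence "((\<lambda>t. t * G l (p x t)) has_vector_derivative A l x t) (at t)"
            by (simp add: has_vector_derivative_def)
          thus ?thesis by (rule has_vector_derivative_at_within)
        qed
        from fundamental_theorem_of_calculus[of 0 1, OF _ this]
        have "(A l x has_integral (1 * G l (p x 1) - 0 * G l (p x 0))) {0..1}" by simp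
        thus ?thesis by (simp add: p_def)
      qed
      hence "((\<lambda>t. \<Sum>l\<in>UNIV. A l x t *\<^sub>R E l) has_integral (\<Sum>l\<in>UNIV. G l x *\<^sub>R E l)) {0..1}"
        by (intro has_integral_sum has_integral_scaleR_left) auto
      hence "(fx x has_integral (\<Sum>l\<in>UNIV. G l x *\<^sub>R E l)) (cbox 0 1)"
        by (simp add: fx_def[abs_def])
      hence "integral (cbox 0 1) (fx x) = (\<Sum>l\<in>UNIV. G l x *\<^sub>R E l)" by (rule integral_unique)
      thus ?thesis by (simp add: blinfun.sum_left blinfun.scaleR_left E fun_eq_iff)
    qed
    ultimately show ?thesis by simp
  qed
  thus ?thesis by (rule that)
qed

text \<open>Symmetry of mixed second weak derivatives makes \<open>G\<close> curl-free, and
  \<open>u\<close> minus a primitive of \<open>G\<close> has zero weak gradient. The primitive is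
  known only on the open outer box, so the comparison takes place on a smaller closed box inside
  it.\<close>

lemma smooth_if_weak_gradient_smooth:
  fixes u :: "real^'n \<Rightarrow> real"
  assumes ab: "\<And>i. a $ i < a' $ i" "\<And>i. a' $ i < b' $ i" "\<And>i. b' $ i < b $ i"
    and V: "open V" "cbox a b \<subseteq> V" and sm: "\<And>j. smooth_on V (G j)" and u: "integrable lebesgue u"
    and weak: "\<And>j \<psi>. bumps a b \<psi> \<Longrightarrow> (LINT x|lebesgue. u x * tensor (\<psi>(j := deriv (\<psi> j))) x) =
      - (LINT x|lebesgue. (indicator (cbox a b) x * G j x) * tensor \<psi> x)"
  obtains h where "smooth_on (box a' b') h" "AE x in lebesgue. x \<in> box a' b' \<longrightarrow> u x = h x"
proof -
  let ?S = "box a b" and ?I = "\<lambda>x. indicator (cbox a b) x :: real"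
  have SV: "?S \<subseteq> V" using V(2) box_subset_cbox[of a b] by blast
  define D where "D j l x = frechet_derivative (G j) (at x) (axis l 1)" for j l x
  have smD: "smooth_on V (D j l)" for j l
    unfolding D_def by (rule smooth_on_frechet_derivative[OF sm])
  have intD: "integrable lebesgue (\<lambda>x. ?I x * D j l x)" for j l
    by (rule integrable_lebesgue_cbox[OF continuous_on_subset[OF smooth_on_imp_continuous_on[OF smD] V(2)]])
  \<comment> \<open>Both derivatives are moved onto the test function, the two minus signs
    cancelling. For distinct coordinates the two updates commute, which is the symmetry in
    \<open>j\<close> and \<open>l\<close>.\<close>
  have DT: "(LINT x|lebesgue. (?I x * D j l x) * tensor \<psi> x) =
      (LINT x|lebesgue. u x * tensor ((\<psi>(l := deriv (\<psi> l)))(j := deriv ((\<psi>(l := deriv (\<psi> l))) j))) x)"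
    if \<psi>: "bumps a b \<psi>" for j l \<psi>
    using integration_by_parts_tensor[OF sm V \<psi>, of j l]
      weak[OF bumps_upd[OF \<psi> bump_deriv[OF bumpsD[OF \<psi>, of l]]], of j]
    by (simp add: D_def)
  have curl: "D j l x = D l j x" if x: "x \<in> ?S" for j l x
  proof (cases "j = l")
    case False
    have "AE x in lebesgue. x \<in> ?S \<longrightarrow> ?I x * D j l x - ?I x * D l j x = 0"
    proof (rule AE_eq_0_if_tensor_integrals_0)
      show "integrable lebesgue (\<lambda>x. ?I x * D j l x - ?I x * D l j x)" by (intro Bochner_Integration.integrable_diff intD)
      fix \<psi> assume \<psi>: "bumps a b \<psi>"
      have "(\<psi>(l := deriv (\<psi> l)))(j := deriv ((\<psi>(l := deriv (\<psi> l))) j)) =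
          (\<psi>(j := deriv (\<psi> j)))(l := deriv ((\<psi>(j := deriv (\<psi> j))) l))"
        using False by (auto simp: fun_eq_iff)
      hence "(LINT x|lebesgue. (?I x * D j l x) * tensor \<psi> x) = (LINT x|lebesgue. (?I x * D l j x) * tensor \<psi> x)"
        unfolding DT[OF \<psi>] by simp
      thus "(LINT x|lebesgue. (?I x * D j l x - ?I x * D l j x) * tensor \<psi> x) = 0"
        using integrable_mult_tensor[OF intD \<psi>, of j l] integrable_mult_tensor[OF intD \<psi>, of l j]
        by (simp add: left_diff_distrib)
    qed
    hence "AE x in lebesgue. x \<in> ?S \<longrightarrow> D j l x - D l j x = 0"
      by eventually_elim (use box_subset_cbox[of a b] in auto)
    moreover have "continuous_on ?S (\<lambda>x. D j l x - D l j x)"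
      by (intro continuous_intros continuous_on_subset[OF smooth_on_imp_continuous_on[OF smD] SV])
    ultimately have "D j l x - D l j x = 0" using continuous_AE_eq_0[OF open_box] x by blast
    thus ?thesis by simp
  qed simp
  have a': "a' \<in> ?S" using ab by (auto simp: mem_box_cart intro: less_trans)
  have smS: "smooth_on ?S (G j)" for j using smooth_on_subset[OF open_box SV sm] .
  have c: "frechet_derivative (G j) (at x) (axis l 1) = frechet_derivative (G l) (at x) (axis j 1)"
    if "x \<in> ?S" for x j l
    using curl[OF that, of j l] by (simp add: D_def)
  obtain h where h: "\<And>x. x \<in> ?S \<Longrightarrow> (h has_derivative (\<lambda>v. \<Sum>j\<in>UNIV. G j x * v $ j)) (at x)"
    using curl_free_imp_gradient[where G=G, OF open_box convex_box(2) a' smS c] by blast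
  have smh: "smooth_on ?S h"
    by (rule smooth_onI_derivative[OF open_box h])
      (auto intro!: smooth_on_sum smooth_on_mult smS smooth_on_const)
  have sub: "cbox a' b' \<subseteq> ?S" using ab by (auto simp: mem_box_cart) (meson le_less_trans less_le_trans)+
  let ?I' = "\<lambda>x. indicator (cbox a' b') x :: real"
  have inth: "integrable lebesgue (\<lambda>x. ?I' x * h x)"
    by (rule integrable_lebesgue_cbox[OF continuous_on_subset[OF smooth_on_imp_continuous_on[OF smh] sub]])
  have intu: "integrable lebesgue (\<lambda>x. u x - ?I' x * h x)"
    by (intro Bochner_Integration.integrable_diff u inth)
  have "(LINT x|lebesgue. (u x - ?I' x * h x) * tensor (\<psi>(j := deriv (\<psi> j))) x) = 0"
    if \<psi>: "bumps a' b' \<psi>" for j \<psi>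
  proof -
    have \<psi>': "bumps a' b' (\<psi>(j := deriv (\<psi> j)))" by (intro bumps_upd \<psi> bump_deriv bumpsD)
    have \<psi>ab: "bumps a b \<psi>"
      using \<psi> ab unfolding bumps_def bump_def by (meson atLeastAtMost_iff less_imp_le order_trans)
    have eqT: "(?I' x * frechet_derivative h (at x) (axis j 1)) * tensor \<psi> x = (?I x * G j x) * tensor \<psi> x" for x
    proof (cases "x \<in> cbox a' b'")
      case True
      hence x: "x \<in> ?S" using sub by blast
      have "frechet_derivative h (at x) (axis j 1) = (\<Sum>l\<in>UNIV. G l x * axis j 1 $ l)"
        using frechet_derivative_at[OF h[OF x]] by metis
      also have "\<dots> = G j x" by (simp add: axis_def if_distrib cong: if_cong)
      finally show ?thesis using True x box_subset_cbox[of a b] by auto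
    next
      case False
      thus ?thesis using tensor_eq_0[OF \<psi>] by simp
    qed
    have "(LINT x|lebesgue. (?I' x * h x) * tensor (\<psi>(j := deriv (\<psi> j))) x) =
        (LINT x|lebesgue. u x * tensor (\<psi>(j := deriv (\<psi> j))) x)"
      unfolding integration_by_parts_tensor[OF smh open_box sub \<psi>] weak[OF \<psi>ab] eqT ..
    thus ?thesis
      using integrable_mult_tensor[OF u \<psi>'] integrable_mult_tensor[OF inth \<psi>']
      by (simp add: left_diff_distrib)
  qed
  then obtain c where c: "AE x in lebesgue. x \<in> box a' b' \<longrightarrow> u x - ?I' x * h x = c"
    using AE_constant_if_weak_gradient_0[OF ab(2) intu] by metis
  show ?thesis
  proof
    have "box a' b' \<subseteq> ?S" using sub box_subset_cbox[of a' b'] by blast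
    thus "smooth_on (box a' b') (\<lambda>x. h x + c)"
      by (intro smooth_on_add smooth_on_const smooth_on_subset[OF _ _ smh]) auto
    show "AE x in lebesgue. x \<in> box a' b' \<longrightarrow> u x = h x + c"
      using c by eventually_elim (use box_subset_cbox[of a' b'] in auto)
  qed
qed

subsection \<open>Local smoothness and gluing\<close>

lemma det_scaleR:
  fixes A :: "real^'n^'n"
  shows "det (c *\<^sub>R A) = c ^ CARD('n) * det A"
  by (simp add: det_def prod.distrib sum_distrib_left mult_ac)

lemma tendsto_matrix_mult:
  fixes X :: "'a \<Rightarrow> real^'m^'n" and Y :: "'a \<Rightarrow> real^'l^'m"
  assumes "(X \<longlongrightarrow> A) F" "(Y \<longlongrightarrow> B) F"
  shows "((\<lambda>x. X x ** Y x) \<longlongrightarrow> A ** B) F"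
proof (intro vec_tendstoI)
  have "((\<lambda>x. \<Sum>l\<in>UNIV. X x $ i $ l * Y x $ l $ j) \<longlongrightarrow> (\<Sum>l\<in>UNIV. A $ i $ l * B $ l $ j)) F" for i j
    by (intro tendsto_sum tendsto_mult tendsto_vec_nth assms)
  thus "((\<lambda>x. (X x ** Y x) $ i $ j) \<longlongrightarrow> (A ** B) $ i $ j) F" for i j
    by (simp add: matrix_matrix_mult_def)
qed

lemma smooth_on_det_nat:
  assumes "open U" "\<And>i j. smooth_on U (\<lambda>x. M x i j)"
  shows "smooth_on U (\<lambda>x. det_nat n (M x))"
  unfolding det_nat_def
  by (intro smooth_on_sum smooth_on_mult smooth_on_prod smooth_on_const assms)

lemma smooth_on_root_pad:
  fixes X :: "real^'n \<Rightarrow> real^('n set)^('n set)"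
  assumes U: "open U" and X: "\<And>I J. smooth_on U (\<lambda>x. X x $ I $ J)"
    and k: "k > 0" "Suc k \<le> CARD('n)"
    and near: "\<And>x. x \<in> U \<Longrightarrow> near_one k (X x)"
  shows "smooth_on U (\<lambda>x. root_pad k (X x) $ i $ j)"
proof -
  let ?I = "pair_set k i j"
  have adj: "smooth_on U (\<lambda>x. adj_of_pad k ?I (X x) a b)" for a b
    unfolding adj_of_pad_def Let_def by (intro smooth_on_mult smooth_on_const U X)
  have det: "smooth_on U (\<lambda>x. det_pad k ?I (X x))"
    unfolding det_pad_def by (intro smooth_on_det_nat U adj)
  have "det_pad k ?I (X x) > 0" if "x \<in> U" for x
    using near[OF that] pair_set(1)[OF k] by (simp add: near_one_def)
  hence "smooth_on U (\<lambda>x. entry_pad k ?I (X x) a b)" for a b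
    unfolding entry_pad_def adj_nat_def
    by (intro smooth_on_mult smooth_on_const smooth_on_det_nat smooth_on_powr U adj det)
  thus ?thesis by (simp add: root_pad_def Let_def)
qed

lemma smooth_on_imp_tendsto_nhds:
  assumes "smooth_on U g" "open U" "x \<in> U"
  shows "(g \<longlongrightarrow> g x) (nhds x)"
  using assms smooth_on_imp_continuous_on[OF assms(1)]
  by (simp add: continuous_on_eq_continuous_at isCont_def tendsto_at_iff_tendsto_nhds)

text \<open>A nearby good point \<open>x1\<close> normalises \<open>Df\<close> by \<open>(Df x1)\<^sup>-\<^sup>1\<close>, after which \<open>\<Lambda>\<^sup>k\<close> is close to the
  identity and its explicit local inverse applies; the sign left open for even \<open>k\<close> is that of the
  determinant because the dimension is then odd.\<close>

lemma derivative_smooth_locally: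
  fixes \<Omega> :: "(real^'n) set" and Df :: "real^'n \<Rightarrow> real^'n^'n"
    and F :: "real^'n \<Rightarrow> 'n set \<Rightarrow> 'n set \<Rightarrow> real"
  assumes open_\<Omega>: "open \<Omega>" and k: "k > 0" "Suc k \<le> CARD('n)"
    and smooth_rep: "\<And>I J. I \<in> ksets k \<Longrightarrow> J \<in> ksets k \<Longrightarrow> smooth_on \<Omega> (\<lambda>x. F x I J)"
    and rep: "AE x in lebesgue. x \<in> \<Omega> \<longrightarrow>
                (\<forall>I\<in>ksets k. \<forall>J\<in>ksets k. F x I J = ext_power k (Df x) I J)"
    and inv: "\<And>x. x \<in> \<Omega> \<Longrightarrow> invertible_on (ksets k) (F x)"
    and sign: "odd k \<or> odd CARD('n) \<and> (AE x in lebesgue. x \<in> \<Omega> \<longrightarrow> s0 * det (Df x) > 0)"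
    and x0: "x0 \<in> \<Omega>"
  obtains U G where "open U" "x0 \<in> U" "U \<subseteq> \<Omega>" "\<And>i j. smooth_on U (G i j)"
    "AE x in lebesgue. x \<in> U \<longrightarrow> (\<forall>i j. Df x $ i $ j = G i j x)"
proof -
  define MF where "MF x = pad k (F x)" for x
  \<comment> \<open>Collects the facts known only almost everywhere; for odd \<open>k\<close> the
    sign clause holds trivially.\<close>
  define good where "good x \<longleftrightarrow> MF x = pad k (ext_power k (Df x)) \<and> (odd k \<or> odd CARD('n) \<and> s0 * det (Df x) > 0)"
    for x
  have AE_good: "AE x in lebesgue. x \<in> \<Omega> \<longrightarrow> good x"
  proof (cases "odd k")
    case True
    with rep show ?thesis by eventually_elim (auto simp: good_def MF_def True intro!: pad_cong)
  next
    case False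
    hence o: "odd CARD('n)" and s: "AE x in lebesgue. x \<in> \<Omega> \<longrightarrow> s0 * det (Df x) > 0" using sign by auto
    show ?thesis using rep s by eventually_elim (auto simp: good_def MF_def o intro!: pad_cong)
  qed
  have smMF: "smooth_on \<Omega> (\<lambda>x. MF x $ I $ J)" for I J
  proof (cases "card I = k \<and> card J = k")
    case True
    thus ?thesis using smooth_rep[of I J] by (simp add: MF_def pad_def ksets_def)
  next
    case False
    hence "(\<lambda>x. MF x $ I $ J) = (\<lambda>_. if I = J then 1 else 0)" by (auto simp: MF_def pad_def)
    thus ?thesis by (simp only: smooth_on_const)
  qed
  have invMF: "invertible (MF x)" if "x \<in> \<Omega>" for x
    unfolding MF_def by (rule invertible_pad[OF inv[OF that]])
  have tMF: "(MF \<longlongrightarrow> MF x0) (nhds x0)"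
    by (intro vec_tendstoI smooth_on_imp_tendsto_nhds[OF smMF open_\<Omega> x0])
  \<comment> \<open>Both the normalising point and the evaluation point vary. The product filter
    yields one neighbourhood valid for every pair, so the normalising point can be chosen after the
    neighbourhood.\<close>
  let ?FF = "nhds x0 \<times>\<^sub>F nhds x0"
  have t1: "((\<lambda>z. MF (fst z)) \<longlongrightarrow> MF x0) ?FF" by (rule filterlim_compose[OF tMF filterlim_fst])
  have t2: "((\<lambda>z. MF (snd z)) \<longlongrightarrow> MF x0) ?FF" by (rule filterlim_compose[OF tMF filterlim_snd])
  have "((\<lambda>z. matrix_inv (MF (fst z)) ** MF (snd z)) \<longlongrightarrow> matrix_inv (MF x0) ** MF x0) ?FF"
    by (intro tendsto_matrix_mult tendsto_matrix_inv t1 t2 invMF x0)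
  hence "((\<lambda>z. matrix_inv (MF (fst z)) ** MF (snd z)) \<longlongrightarrow> mat 1) ?FF"
    by (simp add: matrix_inv invMF[OF x0])
  from eventually_near_one[OF k this]
  obtain Q where Q: "eventually Q (nhds x0)" "\<And>x y. Q x \<Longrightarrow> Q y \<Longrightarrow> near_one k (matrix_inv (MF x) ** MF y)"
    unfolding eventually_prod_same by auto
  obtain U' where U': "open U'" "x0 \<in> U'" "\<And>x. x \<in> U' \<Longrightarrow> Q x" using Q(1) unfolding eventually_nhds by blast
  define U where "U = U' \<inter> \<Omega>"
  have U: "open U" "x0 \<in> U" "U \<subseteq> \<Omega>" and near: "\<And>x y. x \<in> U \<Longrightarrow> y \<in> U \<Longrightarrow> near_one k (matrix_inv (MF x) ** MF y)"
    using U' x0 open_\<Omega> Q(2) by (auto simp: U_def)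
  obtain x1 where x1: "x1 \<in> U" "good x1" using ex_point_of_AE[OF AE_good U(1)] U(2,3) by blast
  define A where "A = Df x1"
  define N where "N = matrix_inv (MF x1)"
  have x1\<Omega>: "x1 \<in> \<Omega>" using x1 U by blast
  have EA: "MF x1 = pad k (ext_power k A)" using x1 by (simp add: good_def A_def)
  have invA: "invertible A" using invertible_if_ext_power[OF k] invMF[OF x1\<Omega>] EA by simp
  \<comment> \<open>Functoriality: the inverse of the exterior power of \<open>A\<close> is that of
    the inverse of \<open>A\<close>, hence \<open>X x\<close> below is the exterior power of
    \<open>matrix_inv A ** Df x\<close> at good points.\<close>
  have N: "N = pad k (ext_power k (matrix_inv A))"
  proof -
    have "pad k (ext_power k (matrix_inv A)) ** MF x1 = mat 1"
      unfolding EA pad_ext_power_mult[symmetric] by (simp add: matrix_inv invA pad_ext_power_one)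
    hence "pad k (ext_power k (matrix_inv A)) ** (MF x1 ** N) = N"
      by (simp add: matrix_mul_assoc)
    thus ?thesis by (simp add: N_def matrix_inv invMF[OF x1\<Omega>])
  qed
  define X where "X x = N ** MF x" for x
  have nearX: "near_one k (X x)" if "x \<in> U" for x
    unfolding X_def N_def by (rule near[OF x1(1) that])
  have smX: "smooth_on U (\<lambda>x. X x $ I $ J)" for I J
    unfolding X_def matrix_matrix_mult_def
    by (auto intro!: smooth_on_sum smooth_on_mult smooth_on_const smooth_on_subset[OF U(1) U(3) smMF] U(1))
  define G where "G i j x = (\<Sum>l\<in>UNIV. A $ i $ l * root_pad k (X x) $ l $ j)" for i j x
  have Df: "Df x = A ** root_pad k (X x)" if x: "x \<in> U" "good x" for x
  proof -
    define B where "B = matrix_inv A ** Df x"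
    have AB: "A ** B = Df x" unfolding B_def by (simp add: matrix_mul_assoc matrix_inv invA)
    have XB: "X x = pad k (ext_power k B)"
      using x(2) by (simp add: X_def B_def N pad_ext_power_mult good_def)
    obtain s :: real where s: "s = 1 \<or> s = -1" "odd k \<Longrightarrow> s = 1" "B = s *\<^sub>R root_pad k (X x)"
      using root_pad_ext_power[OF k, of B] nearX[OF x(1)] unfolding XB by metis
    have "s = 1"
    proof (cases "odd k")
      case False
      hence o: "odd CARD('n)" "s0 * det A > 0" "s0 * det (Df x) > 0"
        using x(2) x1(2) by (auto simp: good_def A_def)
      \<comment> \<open>Both \<open>det A\<close> and \<open>det (Df x)\<close> have the sign of
        \<open>s0\<close>, so \<open>det B\<close> is positive; in odd dimension
        \<open>s = -1\<close> would make it negative.\<close>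
      have "s0 * det A * det B > 0" using o(3) by (simp add: AB[symmetric] det_mul mult.assoc)
      hence "det B > 0" using o(2) by (simp add: zero_less_mult_iff)
      moreover have "det B = s ^ CARD('n) * det (root_pad k (X x))" by (subst s(3)) (rule det_scaleR)
      moreover have "det (root_pad k (X x)) > 0" using nearX[OF x(1)] by (simp add: near_one_def)
      ultimately show ?thesis using s(1) o(1) by (auto simp: zero_less_mult_iff)
    qed (rule s(2))
    thus ?thesis using AB s(3) by simp
  qed
  show ?thesis
  proof
    show "smooth_on U (G i j)" for i j
      unfolding G_def
      by (intro smooth_on_sum smooth_on_mult smooth_on_const U smooth_on_root_pad[OF U(1) smX k nearX])
    show "AE x in lebesgue. x \<in> U \<longrightarrow> (\<forall>i j. Df x $ i $ j = G i j x)"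
      using AE_good
    proof eventually_elim
      case (elim x)
      thus ?case using Df[of x] U(3) by (auto simp: G_def matrix_matrix_mult_def)
    qed
  qed (use U in auto)
qed

text \<open>For \<open>p \<ge> 1\<close> the bound |u| <= 1 + |u|^p holds pointwise, and the
  constant 1 is integrable over a bounded box.\<close>

lemma Lp_on_cbox_integrable:
  fixes \<Omega> :: "(real^'n) set"
  assumes u: "Lp_on \<Omega> p u" and p: "p \<ge> 1" and \<Omega>: "open \<Omega>" "cbox a b \<subseteq> \<Omega>"
  shows "integrable lebesgue (\<lambda>x. indicator (cbox a b) x * u x)"
proof -
  have sets: "\<Omega> \<inter> space lebesgue \<in> sets lebesgue" using \<Omega>(1) by auto
  have m: "(\<lambda>x. indicator \<Omega> x * u x) \<in> borel_measurable lebesgue"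
    using u borel_measurable_restrict_space_iff[OF sets, of u] by (simp add: Lp_on_def)
  have "integrable lebesgue (\<lambda>x. indicator \<Omega> x *\<^sub>R \<bar>u x\<bar> powr p)"
    using u integrable_restrict_space[OF sets, of "\<lambda>x. \<bar>u x\<bar> powr p"]
    unfolding Lp_on_def by blast
  moreover have "integrable lebesgue (\<lambda>x. indicator (cbox a b) x * (1::real))"
    by (intro integrable_lebesgue_cbox continuous_intros)
  ultimately have "integrable lebesgue (\<lambda>x. indicator (cbox a b) x * 1 + indicator \<Omega> x *\<^sub>R \<bar>u x\<bar> powr p)"
    by (rule Bochner_Integration.integrable_add[rotated])
  thus ?thesis
  proof (rule Bochner_Integration.integrable_bound)
    have "(\<lambda>x. indicator (cbox a b) x * (indicator \<Omega> x * u x)) \<in> borel_measurable lebesgue"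
      by (intro borel_measurable_times borel_measurable_indicator m) auto
    moreover have "indicator (cbox a b) x * (indicator \<Omega> x * u x) = indicator (cbox a b) x * u x" for x
      using \<Omega>(2) by (auto simp: indicator_def)
    ultimately show "(\<lambda>x. indicator (cbox a b) x * u x) \<in> borel_measurable lebesgue" by simp
    have bound: "\<bar>u x\<bar> \<le> 1 + \<bar>u x\<bar> powr p" for x
    proof (cases "\<bar>u x\<bar> \<le> 1")
      case True
      thus ?thesis using powr_ge_zero[of "\<bar>u x\<bar>" p] by linarith
    next
      case False
      hence "\<bar>u x\<bar> powr 1 \<le> \<bar>u x\<bar> powr p" using p by (intro powr_mono) auto
      thus ?thesis using False by simp
    qed
    show "AE x in lebesgue. norm (indicator (cbox a b) x * u x)
      \<le> norm (indicator (cbox a b) x * 1 + indicator \<Omega> x *\<^sub>R \<bar>u x\<bar> powr p)"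
    proof (intro AE_I2)
      fix x
      show "norm (indicator (cbox a b) x * u x) \<le> norm (indicator (cbox a b) x * 1 + indicator \<Omega> x *\<^sub>R \<bar>u x\<bar> powr p)"
        using bound[of x] \<Omega>(2) by (cases "x \<in> cbox a b") (auto simp: abs_of_nonneg)
    qed
  qed
qed

lemma sobolev_smooth_locally:
  fixes \<Omega> :: "(real^'n) set"
  assumes sob: "sobolev_W1p_with_deriv \<Omega> p f Df" and p: "p \<ge> 1" and \<Omega>: "open \<Omega>"
    and U: "open U" "x0 \<in> U" "U \<subseteq> \<Omega>" and G: "\<And>i j. smooth_on U (G i j)"
    and Df: "AE x in lebesgue. x \<in> U \<longrightarrow> (\<forall>i j. Df x $ i $ j = G i j x)"
  obtains W h where "open W" "x0 \<in> W" "W \<subseteq> \<Omega>" "smooth_on W h"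
    "AE x in lebesgue. x \<in> W \<longrightarrow> f x = h x"
proof -
  obtain a b where ab: "cbox a b \<subseteq> U" "x0 \<in> box a b" using open_contains_cbox[OF U(1,2)] by metis
  have ab\<Omega>: "cbox a b \<subseteq> \<Omega>" using ab U by blast
  \<comment> \<open>Midpoints between \<open>x0\<close> and the corners give a box around
    \<open>x0\<close> strictly inside the outer one.\<close>
  define a' b' where "a' = (1/2) *\<^sub>R (a + x0)" and "b' = (1/2) *\<^sub>R (x0 + b)"
  have x0: "a $ i < x0 $ i" "x0 $ i < b $ i" for i using ab(2) by (auto simp: mem_box_cart)
  have lt: "a $ i < a' $ i" "a' $ i < b' $ i" "b' $ i < b $ i" for i
    using x0[of i] by (auto simp: a'_def b'_def)
  have x0': "x0 \<in> box a' b'" using x0 by (auto simp: mem_box_cart a'_def b'_def field_simps)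
  have "\<exists>h. smooth_on (box a' b') h \<and> (AE x in lebesgue. x \<in> box a' b' \<longrightarrow> f x $ i = h x)" for i
  proof -
    let ?I = "\<lambda>x. indicator (cbox a b) x :: real"
    have Lp: "Lp_on \<Omega> p (\<lambda>x. f x $ i)" "\<And>j. Lp_on \<Omega> p (\<lambda>x. Df x $ i $ j)"
      and wk: "\<And>j. weak_partial \<Omega> (\<lambda>x. f x $ i) j (\<lambda>x. Df x $ i $ j)"
      using sob by (auto simp: sobolev_W1p_with_deriv_def)
    have u: "integrable lebesgue (\<lambda>x. ?I x * f x $ i)"
      by (rule Lp_on_cbox_integrable[OF Lp(1) p \<Omega> ab\<Omega>])
    have uD: "integrable lebesgue (\<lambda>x. ?I x * Df x $ i $ j)" for j
      by (rule Lp_on_cbox_integrable[OF Lp(2) p \<Omega> ab\<Omega>])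
    have uG: "integrable lebesgue (\<lambda>x. ?I x * G i j x)" for j
      by (rule integrable_lebesgue_cbox[OF continuous_on_subset[OF smooth_on_imp_continuous_on[OF G] ab(1)]])
    have weak: "(LINT x|lebesgue. (?I x * f x $ i) * tensor (\<psi>(j := deriv (\<psi> j))) x) =
      - (LINT x|lebesgue. (?I x * G i j x) * tensor \<psi> x)" if \<psi>: "bumps a b \<psi>" for j \<psi>
    proof -
      have \<psi>': "bumps a b (\<psi>(j := deriv (\<psi> j)))" by (intro bumps_upd \<psi> bump_deriv bumpsD)
      \<comment> \<open>Tensor products vanish off the box, so integrals over
        \<open>\<Omega>\<close> and over the box coincide.\<close>
      have cut: "indicator \<Omega> x *\<^sub>R (g * tensor \<phi> x) = (?I x * g) * tensor \<phi> x" if "bumps a b \<phi>" for \<phi> g x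
        using tensor_eq_0[OF that, of x] ab\<Omega> by (cases "x \<in> cbox a b") auto
      have "(LINT x|lebesgue. (?I x * f x $ i) * tensor (\<psi>(j := deriv (\<psi> j))) x) =
          (LINT x:\<Omega>|lebesgue. f x $ i * partial_deriv j (tensor \<psi>) x)"
        unfolding set_lebesgue_integral_def partial_deriv_def tensor_has_partial[OF \<psi>] cut[OF \<psi>'] ..
      also have "\<dots> = - (LINT x:\<Omega>|lebesgue. Df x $ i $ j * tensor \<psi> x)"
        using wk test_fun_tensor[OF \<psi> ab\<Omega>] by (simp add: weak_partial_def)
      also have "(LINT x:\<Omega>|lebesgue. Df x $ i $ j * tensor \<psi> x) =
          (LINT x|lebesgue. (?I x * Df x $ i $ j) * tensor \<psi> x)"
        unfolding set_lebesgue_integral_def cut[OF \<psi>] ..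
      also have "\<dots> = (LINT x|lebesgue. (?I x * G i j x) * tensor \<psi> x)"
      proof (rule integral_cong_AE)
        show "(\<lambda>x. (?I x * Df x $ i $ j) * tensor \<psi> x) \<in> borel_measurable lebesgue"
          by (rule borel_measurable_integrable[OF integrable_mult_tensor[OF uD \<psi>]])
        show "(\<lambda>x. (?I x * G i j x) * tensor \<psi> x) \<in> borel_measurable lebesgue"
          by (rule borel_measurable_integrable[OF integrable_mult_tensor[OF uG \<psi>]])
        show "AE x in lebesgue. (?I x * Df x $ i $ j) * tensor \<psi> x = (?I x * G i j x) * tensor \<psi> x"
          using Df by eventually_elim (use ab(1) in \<open>auto simp: indicator_def\<close>)
      qed
      finally show ?thesis .
    qed
    obtain h where h: "smooth_on (box a' b') h"
      "AE x in lebesgue. x \<in> box a' b' \<longrightarrow> ?I x * f x $ i = h x"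
      by (rule smooth_if_weak_gradient_smooth[OF lt U(1) ab(1) G u weak])
    have "box a' b' \<subseteq> cbox a b"
      using lt by (auto simp: mem_box_cart) (meson less_imp_le less_trans)+
    hence "AE x in lebesgue. x \<in> box a' b' \<longrightarrow> f x $ i = h x"
      using h(2) by (auto elim!: eventually_mono simp: indicator_def split: if_splits)
    thus ?thesis using h(1) by blast
  qed
  hence "\<forall>i. \<exists>h. smooth_on (box a' b') h \<and> (AE x in lebesgue. x \<in> box a' b' \<longrightarrow> f x $ i = h x)" ..
  from choice[OF this] obtain h where h: "\<And>i. smooth_on (box a' b') (h i)"
    "\<And>i. AE x in lebesgue. x \<in> box a' b' \<longrightarrow> f x $ i = h i x" by blast
  have "AE x in lebesgue. \<forall>i\<in>UNIV. x \<in> box a' b' \<longrightarrow> f x $ i = h i x"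
    using h(2) by (intro AE_finite_allI) auto
  hence AE: "AE x in lebesgue. x \<in> box a' b' \<longrightarrow> f x = (\<chi> i. h i x)"
    by eventually_elim (simp add: vec_eq_iff)
  show ?thesis
  proof
    show "box a' b' \<subseteq> \<Omega>"
      using lt ab\<Omega> by (auto simp: mem_box_cart subset_iff) (meson less_imp_le less_trans)
    show "smooth_on (box a' b') (\<lambda>x. \<chi> i. h i x)" using h(1) by (intro smooth_on_vec) auto
  qed (use x0' AE in auto)
qed

text \<open>Two local representatives are continuous and agree a.e. on the overlap of their domains,
  hence everywhere there; so evaluating at \<open>x\<close> the representative chosen for
  \<open>x\<close> gives a well-behaved global function.\<close>

lemma smooth_representative_glue:
  fixes f :: "real^'n \<Rightarrow> real^'n"
  assumes \<Omega>: "open \<Omega>"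
    and loc: "\<And>x. x \<in> \<Omega> \<Longrightarrow> \<exists>W h. open W \<and> x \<in> W \<and> W \<subseteq> \<Omega> \<and> smooth_on W h \<and>
      (AE y in lebesgue. y \<in> W \<longrightarrow> f y = h y)"
  shows "\<exists>g. smooth_on \<Omega> g \<and> (AE x in lebesgue. x \<in> \<Omega> \<longrightarrow> f x = g x)"
proof -
  define rep where "rep x W h \<longleftrightarrow> open W \<and> x \<in> W \<and> W \<subseteq> \<Omega> \<and> smooth_on W h \<and>
      (AE y in lebesgue. y \<in> W \<longrightarrow> f y = h y)" for x W and h :: "real^'n \<Rightarrow> real^'n"
  have "\<forall>x\<in>\<Omega>. \<exists>W. \<exists>h. rep x W h" using loc unfolding rep_def by blast
  from bchoice[OF this] obtain W where "\<forall>x\<in>\<Omega>. \<exists>h. rep x (W x) h" by (rule exE)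
  from bchoice[OF this] obtain h where "\<forall>x\<in>\<Omega>. rep x (W x) (h x)" by (rule exE)
  hence W: "open (W x) \<and> x \<in> W x \<and> W x \<subseteq> \<Omega> \<and> smooth_on (W x) (h x) \<and>
      (AE y in lebesgue. y \<in> W x \<longrightarrow> f y = h x y)" if "x \<in> \<Omega>" for x
    using that unfolding rep_def by blast
  define g where "g x = h x x" for x
  have eq: "g y = h x y" if x: "x \<in> \<Omega>" and y: "y \<in> W x" for x y
  proof -
    have y\<Omega>: "y \<in> \<Omega>" using W[OF x] y by blast
    let ?S = "W x \<inter> W y"
    have S: "open ?S" using W[OF x] W[OF y\<Omega>] by auto
    have "smooth_on ?S (h y)" "smooth_on ?S (h x)"
      using W[OF x] W[OF y\<Omega>] by (auto intro: smooth_on_subset[OF S])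
    hence "continuous_on ?S (\<lambda>z. h y z - h x z)"
      by (intro continuous_intros smooth_on_imp_continuous_on)
    moreover have "AE z in lebesgue. z \<in> W x \<longrightarrow> f z = h x z" "AE z in lebesgue. z \<in> W y \<longrightarrow> f z = h y z"
      using W[OF x] W[OF y\<Omega>] by auto
    hence "AE z in lebesgue. z \<in> ?S \<longrightarrow> h y z - h x z = 0" by eventually_elim auto
    ultimately have "h y y - h x y = 0" using continuous_AE_eq_0[OF S] y W[OF y\<Omega>] by blast
    thus ?thesis by (simp add: g_def)
  qed
  have "smooth_on \<Omega> g"
  proof (rule smooth_on_local[OF _ \<Omega>])
    fix x assume x: "x \<in> \<Omega>"
    have "smooth_on (W x) g"
      using W[OF x] eq[OF x] by (intro smooth_on_cong[of "W x" "h x" g]) auto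
    thus "\<exists>V. open V \<and> x \<in> V \<and> smooth_on V g" using W[OF x] by blast
  qed
  moreover have "AE x in lebesgue. x \<in> \<Omega> \<longrightarrow> f x = g x"
  proof -
    \<comment> \<open>A countable subcover keeps the union of the exceptional null sets
      null.\<close>
    obtain \<W> where \<W>: "\<W> \<subseteq> W ` \<Omega>" "countable \<W>" "\<Union>\<W> = \<Union>(W ` \<Omega>)"
      using Lindelof[of "W ` \<Omega>"] W by blast
    have "AE x in lebesgue. x \<in> V \<longrightarrow> f x = g x" if "V \<in> \<W>" for V
    proof -
      obtain x where x: "x \<in> \<Omega>" "V = W x" using \<W>(1) \<open>V \<in> \<W>\<close> by blast
      have "AE y in lebesgue. y \<in> W x \<longrightarrow> f y = h x y" using W[OF x(1)] by blast
      thus ?thesis unfolding x(2) by eventually_elim (simp add: eq[OF x(1)])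
    qed
    hence "AE x in lebesgue. \<forall>V\<in>\<W>. x \<in> V \<longrightarrow> f x = g x"
      unfolding AE_ball_countable[OF \<W>(2)] ..
    moreover have "\<Omega> \<subseteq> \<Union>\<W>" using W \<W>(3) by blast
    ultimately show ?thesis by (auto elim!: eventually_mono)
  qed
  ultimately show ?thesis by blast
qed

theorem mainTheorem1:
  fixes \<Omega> :: "(real^'n) set" and k :: nat and p :: real
    and f :: "real^'n \<Rightarrow> real^'n" and Df :: "real^'n \<Rightarrow> real^'n^'n"
    and F :: "real^'n \<Rightarrow> 'n set \<Rightarrow> 'n set \<Rightarrow> real"
  assumes d: "CARD('n) > 2"
    and open_\<Omega>: "open \<Omega>"
    and k: "2 \<le> k" "k \<le> CARD('n) - 1"
    and p: "p \<ge> 1"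
    and sob: "sobolev_W1p_with_deriv \<Omega> p f Df"
    and smooth_rep: "\<forall>I\<in>ksets k. \<forall>J\<in>ksets k. smooth_on \<Omega> (\<lambda>x. F x I J)"
    and rep: "AE x in lebesgue. x \<in> \<Omega> \<longrightarrow>
                (\<forall>I\<in>ksets k. \<forall>J\<in>ksets k. F x I J = ext_power k (Df x) I J)"
    and inv: "\<forall>x\<in>\<Omega>. invertible_on (ksets k) (F x)"
    and parity: "\<not> (even k \<and> even CARD('n))"
    and sign: "odd k \<or> (AE x in lebesgue. x \<in> \<Omega> \<longrightarrow> det (Df x) > 0)
                     \<or> (AE x in lebesgue. x \<in> \<Omega> \<longrightarrow> det (Df x) < 0)"
  shows "\<exists>g. smooth_on \<Omega> g \<and> (AE x in lebesgue. x \<in> \<Omega> \<longrightarrow> f x = g x)"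
proof -
  have k': "k > 0" "Suc k \<le> CARD('n)" using k d by auto
  \<comment> \<open>The factor 1 or -1 treats both orientations at once; for even \<open>k\<close>
    the parity assumption makes the dimension odd.\<close>
  obtain s0 :: real where s0: "odd k \<or> odd CARD('n) \<and> (AE x in lebesgue. x \<in> \<Omega> \<longrightarrow> s0 * det (Df x) > 0)"
  proof (cases "AE x in lebesgue. x \<in> \<Omega> \<longrightarrow> det (Df x) > 0")
    case True
    thus ?thesis using parity that[of 1] by auto
  next
    case False
    thus ?thesis using parity sign that[of "-1"] by auto
  qed
  show ?thesis
  proof (rule smooth_representative_glue[OF open_\<Omega>])
    fix x assume x: "x \<in> \<Omega>"
    obtain U G where U: "open U" "x \<in> U" "U \<subseteq> \<Omega>" "\<And>i j. smooth_on U (G i j)"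
      "AE x in lebesgue. x \<in> U \<longrightarrow> (\<forall>i j. Df x $ i $ j = G i j x)"
      using derivative_smooth_locally[OF open_\<Omega> k' _ rep _ s0 x] smooth_rep inv by blast
    show "\<exists>W h. open W \<and> x \<in> W \<and> W \<subseteq> \<Omega> \<and> smooth_on W h \<and> (AE y in lebesgue. y \<in> W \<longrightarrow> f y = h y)"
      by (rule sobolev_smooth_locally[OF sob p open_\<Omega> U]) blast
  qed
qed

end
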